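(* Let $\rho_0$ be a state of rank $r$ on a $d$-dimensional Hilbert space $\mathcal{H}$, let $A$ be a self-adjoint operator on $\mathcal{H}$, and let $\Psi(\rho)=\mathrm{Tr}(A\rho)$. Then there exists $\varepsilon$ with $0<\varepsilon<1/2$ such that $$\lim_{n\to\infty}\ \inf_{\hat\Psi}\ \sup_{\rho\in\Sigma_{n,\varepsilon}(\rho_0)}E_\rho\Big(n^{1/2}\big(\hat\Psi-\Psi(\rho)\big)\Big)^2=V_{\rho_0}^2,$$ where $V_{\rho_0}^2=\mathrm{Tr}(A^2\rho_0)-(\mathrm{Tr}(A\rho_0))^2$. Here $E_\rho(n^{1/2}(\hat\Psi-\Psi(\rho)))^2=\int(n^{1/2}(\hat\Psi-\Psi(\rho)))^2\,\mathrm{Tr}(\rho^{\otimes n}M(d\hat\Psi))$ and the infimum over $\hat\Psi$ means the infimum over all POVMs $M$ on $\mathcal{H}^{\otimes n}$ with outcomes $\hat\Psi\in\mathbb{R}$.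
   Context: A state is a positive semidefinite operator of trace one; $\|X\|_1=\mathrm{Tr}|X|$ is the trace norm. For the rank $r$ state $\rho_0$, $$\Sigma_{n,\varepsilon}(\rho_0)=\{\rho:\ \rho\text{ is a rank }r\text{ state on }\mathcal{H},\ \|\rho-\rho_0\|_1\le n^{-1/2+\varepsilon}\}.$$ A POVM is a map from measurable sets of outcomes to positive operators which is $\sigma$-additive and normalized to the identity; measuring $M$ on $\rho^{\otimes n}$ gives an outcome with law $B\mapsto\mathrm{Tr}(\rho^{\otimes n}M(B))$. *)

theory Defs
  imports
    "HOL-Analysis.Analysis"
    "Jordan_Normal_Form.Schur_Decomposition"
    "Jordan_Normal_Form.DL_Rank"
begin

text \<open>
  The \<open>d\<close>-dimensional Hilbert space is \<open>\<complex>\<^sup>d\<close>, and operators on it are the matrices in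
  \<open>carrier_mat d d\<close>. Its \<open>n\<close>-fold tensor power is \<open>\<complex>\<^bsup>d^n\<^esup>\<close>, with the product basis ordered
  lexicographically.
\<close>

definition mat_tr :: "complex mat \<Rightarrow> complex" where
  "mat_tr A = (\<Sum>i<dim_row A. A $$ (i, i))"

definition self_adjoint :: "nat \<Rightarrow> complex mat \<Rightarrow> bool" where
  "self_adjoint d A \<longleftrightarrow> A \<in> carrier_mat d d \<and> mat_adjoint A = A"

text \<open>
  The order on \<^typ>\<open>complex\<close> is that of \<^theory>\<open>HOL-Library.Complex_Order\<close>: \<open>0 \<le> z\<close> says that
  \<open>z\<close> is real and nonnegative.
\<close>

definition psd :: "nat \<Rightarrow> complex mat \<Rightarrow> bool" where
  "psd d A \<longleftrightarrow> A \<in> carrier_mat d d \<and> (\<forall>v\<in>carrier_vec d. 0 \<le> (A *\<^sub>v v) \<bullet>c v)"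

definition state :: "nat \<Rightarrow> complex mat \<Rightarrow> bool" where
  "state d \<rho> \<longleftrightarrow> psd d \<rho> \<and> mat_tr \<rho> = 1"

text \<open>The absolute value is the unique positive semidefinite square root of \<open>X\<^sup>* X\<close>.\<close>

definition mat_abs :: "complex mat \<Rightarrow> complex mat" where
  "mat_abs X = (THE P. psd (dim_col X) P \<and> P * P = mat_adjoint X * X)"

definition trace_norm :: "complex mat \<Rightarrow> real" where
  "trace_norm X = Re (mat_tr (mat_abs X))"

definition kron :: "complex mat \<Rightarrow> complex mat \<Rightarrow> complex mat" where
  "kron A B = mat (dim_row A * dim_row B) (dim_col A * dim_col B)
     (\<lambda>(i, j). A $$ (i div dim_row B, j div dim_col B) * B $$ (i mod dim_row B, j mod dim_col B))"

primrec tensor_power :: "complex mat \<Rightarrow> nat \<Rightarrow> complex mat" where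
  "tensor_power A 0 = 1\<^sub>m 1"
| "tensor_power A (Suc n) = kron A (tensor_power A n)"

definition rank_state_ball :: "nat \<Rightarrow> nat \<Rightarrow> nat \<Rightarrow> real \<Rightarrow> complex mat \<Rightarrow> complex mat set" where
  "rank_state_ball d r n \<epsilon> \<rho>\<^sub>0 =
     {\<rho>. state d \<rho> \<and> vec_space.rank d \<rho> = r \<and> trace_norm (\<rho> - \<rho>\<^sub>0) \<le> real n powr (- 1 / 2 + \<epsilon>)}"

text \<open>
  The outcome space is the measurable space underlying \<open>S\<close>. In finite dimension all
  operator topologies coincide, so convergence of the series in the \<open>\<sigma>\<close>-additivity condition is
  stated entrywise.
\<close>

definition povm :: "nat \<Rightarrow> 'o measure \<Rightarrow> ('o set \<Rightarrow> complex mat) \<Rightarrow> bool" where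
  "povm N S M \<longleftrightarrow>
     (\<forall>B\<in>sets S. psd N (M B)) \<and>
     M (space S) = 1\<^sub>m N \<and>
     (\<forall>F :: nat \<Rightarrow> 'o set. range F \<subseteq> sets S \<longrightarrow> disjoint_family F \<longrightarrow>
        (\<forall>i<N. \<forall>j<N. (\<lambda>k. M (F k) $$ (i, j)) sums (M (\<Union>k. F k) $$ (i, j))))"

text \<open>
  For positive semidefinite \<open>R\<close> and \<open>M B\<close> the trace of \<open>R * M B\<close> is a nonnegative real, so neither
  \<^const>\<open>Re\<close> nor \<^const>\<open>ennreal\<close> changes its value.
\<close>

definition outcome_law :: "complex mat \<Rightarrow> 'o measure \<Rightarrow> ('o set \<Rightarrow> complex mat) \<Rightarrow> 'o measure" where
  "outcome_law R S M = measure_of (space S) (sets S) (\<lambda>B. ennreal (Re (mat_tr (R * M B))))"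

text \<open>The functional \<open>\<rho> \<mapsto> Tr (A \<rho>)\<close>, which is real for self-adjoint \<open>A\<close> and \<open>\<rho>\<close>.\<close>

definition expval :: "complex mat \<Rightarrow> complex mat \<Rightarrow> real" where
  "expval A \<rho> = Re (mat_tr (A * \<rho>))"

text \<open>
  The risk may be infinite, so it is a nonnegative extended real, and the infimum and supremum
  over it are taken there.
\<close>

definition quad_risk :: "complex mat \<Rightarrow> nat \<Rightarrow> (real set \<Rightarrow> complex mat) \<Rightarrow> complex mat \<Rightarrow> ennreal" where
  "quad_risk A n M \<rho> =
     (\<integral>\<^sup>+ x. ennreal ((real n powr (1 / 2) * (x - expval A \<rho>))\<^sup>2)
        \<partial>outcome_law (tensor_power \<rho> n) borel M)"

end

theory Submission
  imports
    Defs
    "Jordan_Normal_Form.Spectral_Radius"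
    "HOL-Real_Asymp.Real_Asymp"
begin

text \<open>
  Upper bound. Measure \<open>A\<close> by its spectral measure on each of the \<open>n\<close> copies and report the
  sample mean. Under \<open>\<rho>\<^sup>\<otimes>\<^sup>n\<close> this is a mean of \<open>n\<close> independent variables with
  expectation \<open>Tr (A \<rho>)\<close>, so its rescaled risk is the variance \<open>Tr (A\<^sup>2 \<rho>) - (Tr (A \<rho>))\<^sup>2\<close>
  exactly (\<open>sample_mean_risk\<close>). The variance is Lipschitz in \<open>\<rho>\<close> for the trace norm
  (\<open>variance_difference_le\<close>), and the ball shrinks, so the supremum tends to the variance at
  \<open>\<rho>\<^sub>0\<close>.
  
  Lower bound. Let \<open>V\<^sup>2\<close> be the variance of \<open>A\<close> at \<open>\<rho>\<^sub>0\<close>, suppose \<open>V > 0\<close>, and put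
  \<open>B = (A - Tr (A \<rho>\<^sub>0)) / V\<close>, which has mean 0 and variance 1 in the state \<open>\<rho>\<^sub>0\<close>. With
  \<open>K\<^sub>t = cos t + sin t B\<close> and \<open>\<rho>\<^sub>0 = R R\<^sup>*\<close>, the matrices \<open>W\<^sub>t = K\<^sub>t R\<close> run through a
  great circle of the Hilbert-Schmidt unit sphere. Hence \<open>\<rho>\<^sub>t = W\<^sub>t W\<^sub>t\<^sup>* = K\<^sub>t \<rho>\<^sub>0 K\<^sub>t\<close> is a
  state without any normalisation, it has the rank of \<open>\<rho>\<^sub>0\<close> while \<open>K\<^sub>t\<close> is invertible, and
  \<open>Tr (A \<rho>\<^sub>t) = Tr (A \<rho>\<^sub>0) + 2 V t + O (t\<^sup>2)\<close>. The overlap of the \<open>n\<close>-fold tensor powers of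
  \<open>W\<^sub>s\<close> and \<open>W\<^sub>t\<close> is \<open>cos (s - t) ^ n\<close>, so their distance is at most \<open>sqrt n \<bar>s - t\<bar>\<close>
  (\<open>tensor_W_distance\<close>).
  
  The Cauchy-Schwarz inequality for the positive form \<open>(P, Q) \<mapsto> Tr (P\<^sup>* M Q)\<close> bounds the
  difference of the two mean values of an estimator by this distance and its two second moments
  (\<open>outcome_law_mean_difference\<close>). If the risk is at most \<open>r\<close> for all \<open>t\<close> in \<open>[0, T]\<close>, adding
  up this bound over finer and finer partitions shows that the mean value of the estimator moves by
  at most \<open>2 sqrt r T\<close> from 0 to \<open>T\<close>, while it stays within \<open>sqrt (r / n)\<close> of \<open>Tr (A \<rho>\<^sub>t)\<close>
  (\<open>estimation_bound_along_curve\<close>). Therefore \<open>2 V T + O (T\<^sup>2) \<le> 2 sqrt r (T + 1 / sqrt n)\<close>. This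
  plays the part of the Cramer-Rao inequality for biased estimators. The bound gives \<open>r \<ge> V\<^sup>2 - o (1)\<close> as soon as \<open>T \<rightarrow> 0\<close> and \<open>T sqrt n \<rightarrow> \<infinity>\<close>. With
  \<open>\<epsilon> = 1/4\<close> the radius of the ball is \<open>n\<^bsup>-1/4\<^esup>\<close>, so \<open>T = n\<^bsup>-3/8\<^esup>\<close> keeps the curve inside the
  ball and meets both requirements (\<open>local_minimax_lower_bound\<close>).
\<close>

unbundle no vec_syntax

section \<open>Adjoint, trace and Kronecker powers\<close>

lemma mat_adjoint_dim [simp]:
  "dim_row (mat_adjoint A) = dim_col A" "dim_col (mat_adjoint A) = dim_row A"
  by (auto simp: mat_adjoint_def)

lemma mat_adjoint_carrier [simp]: "A \<in> carrier_mat a b \<Longrightarrow> mat_adjoint A \<in> carrier_mat b a"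
  by auto

lemma mat_adjoint_index [simp]:
  fixes A :: "complex mat"
  assumes "i < dim_col A" "j < dim_row A"
  shows "mat_adjoint A $$ (i, j) = cnj (A $$ (j, i))"
  using assms by (simp add: mat_adjoint_def mat_of_rows_def)

lemma mult_mat_index:
  assumes "i < dim_row A" "j < dim_col B" "dim_col A = dim_row B"
  shows "(A * B) $$ (i, j) = (\<Sum>k<dim_row B. A $$ (i, k) * B $$ (k, j))"
  using assms by (simp add: scalar_prod_def lessThan_atLeast0)

lemma mat_adjoint_mult:
  fixes A B :: "complex mat"
  assumes "A \<in> carrier_mat a b" "B \<in> carrier_mat b c"
  shows "mat_adjoint (A * B) = mat_adjoint B * mat_adjoint A"
  using assms by (intro eq_matI) (auto simp: mult_mat_index cnj_sum mult.commute simp del: index_mult_mat(1))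

lemma mat_adjoint_adjoint [simp]: "mat_adjoint (mat_adjoint A) = (A :: complex mat)"
  by (intro eq_matI) auto

lemma mat_adjoint_one [simp]: "mat_adjoint (1\<^sub>m n) = (1\<^sub>m n :: complex mat)"
  by (intro eq_matI) auto

lemma mat_adjoint_add:
  fixes A B :: "complex mat"
  assumes "A \<in> carrier_mat a b" "B \<in> carrier_mat a b"
  shows "mat_adjoint (A + B) = mat_adjoint A + mat_adjoint B"
  using assms by (intro eq_matI) auto

lemma mat_adjoint_minus:
  fixes A B :: "complex mat"
  assumes "A \<in> carrier_mat a b" "B \<in> carrier_mat a b"
  shows "mat_adjoint (A - B) = mat_adjoint A - mat_adjoint B"
  using assms by (intro eq_matI) auto

lemma mat_adjoint_smult: "mat_adjoint (c \<cdot>\<^sub>m A) = cnj c \<cdot>\<^sub>m mat_adjoint (A :: complex mat)"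
  by (intro eq_matI) auto

lemma mat_tr_carrier: "A \<in> carrier_mat n m \<Longrightarrow> mat_tr A = (\<Sum>i<n. A $$ (i, i))"
  by (auto simp: mat_tr_def)

lemma mat_tr_comm:
  assumes "A \<in> carrier_mat a b" "B \<in> carrier_mat b a"
  shows "mat_tr (A * B) = mat_tr (B * A)"
proof -
  have "mat_tr (A * B) = (\<Sum>i<a. \<Sum>k<b. A $$ (i, k) * B $$ (k, i))"
    using assms by (auto simp: mat_tr_def mult_mat_index simp del: index_mult_mat(1))
  also have "\<dots> = (\<Sum>k<b. \<Sum>i<a. B $$ (k, i) * A $$ (i, k))"
    by (subst sum.swap) (simp add: mult.commute)
  also have "\<dots> = mat_tr (B * A)"
    using assms by (auto simp: mat_tr_def mult_mat_index simp del: index_mult_mat(1))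
  finally show ?thesis .
qed

lemma mat_tr_add:
  "A \<in> carrier_mat n n \<Longrightarrow> B \<in> carrier_mat n n \<Longrightarrow> mat_tr (A + B) = mat_tr A + mat_tr B"
  by (auto simp: mat_tr_def sum.distrib)

lemma mat_tr_minus:
  "A \<in> carrier_mat n n \<Longrightarrow> B \<in> carrier_mat n n \<Longrightarrow> mat_tr (A - B) = mat_tr A - mat_tr B"
  by (auto simp: mat_tr_def sum_subtractf)

lemma mat_tr_smult: "A \<in> carrier_mat n n \<Longrightarrow> mat_tr (c \<cdot>\<^sub>m A) = c * mat_tr A"
  by (auto simp: mat_tr_def sum_distrib_left)

lemma mat_tr_adjoint: "A \<in> carrier_mat n n \<Longrightarrow> mat_tr (mat_adjoint A) = cnj (mat_tr A)"
  by (auto simp: mat_tr_def)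

lemma mat_tr_one [simp]: "mat_tr (1\<^sub>m n) = of_nat n"
  by (simp add: mat_tr_def)

text \<open>
  An index of a Kronecker product is a pair of digits; this turns sums over such indices into
  double sums.
\<close>

lemma sum_lessThan_div_mod:
  fixes f :: "nat \<Rightarrow> nat \<Rightarrow> 'a::comm_monoid_add"
  shows "(\<Sum>k<b * d. f (k div d) (k mod d)) = (\<Sum>i<b. \<Sum>j<d. f i j)"
proof -
  have "(\<Sum>k<b * d. f (k div d) (k mod d)) = (\<Sum>i<b. \<Sum>k = i * d..<i * d + d. f (k div d) (k mod d))"
    by (simp add: sum.nat_group)
  also have "\<dots> = (\<Sum>i<b. \<Sum>j<d. f i j)"
  proof (rule sum.cong[OF refl])
    fix i assume "i \<in> {..<b}"
    have "(\<Sum>k = i * d..<i * d + d. f (k div d) (k mod d)) = (\<Sum>j<d. f ((i * d + j) div d) ((i * d + j) mod d))"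
      by (rule sum.reindex_bij_witness[of _ "\<lambda>j. i * d + j" "\<lambda>k. k - i * d"]) auto
    also have "\<dots> = (\<Sum>j<d. f i j)"
      by (rule sum.cong) (auto simp: div_add1_eq)
    finally show "(\<Sum>k = i * d..<i * d + d. f (k div d) (k mod d)) = (\<Sum>j<d. f i j)" .
  qed
  finally show ?thesis .
qed

lemma div_mod_less:
  assumes "(k::nat) < b * d"
  shows "k div d < b" "k mod d < d"
proof -
  have "d > 0" using assms by (cases d) auto
  then show "k div d < b" "k mod d < d"
    using assms by (auto simp: less_mult_imp_div_less)
qed

lemma dim_kron [simp]:
  "dim_row (kron A B) = dim_row A * dim_row B" "dim_col (kron A B) = dim_col A * dim_col B"
  by (auto simp: kron_def)

lemma kron_carrier [simp]:
  "A \<in> carrier_mat a b \<Longrightarrow> B \<in> carrier_mat c d \<Longrightarrow> kron A B \<in> carrier_mat (a * c) (b * d)"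
  by (auto simp: kron_def)

lemma kron_index:
  "i < dim_row A * dim_row B \<Longrightarrow> j < dim_col A * dim_col B \<Longrightarrow>
   kron A B $$ (i, j) = A $$ (i div dim_row B, j div dim_col B) * B $$ (i mod dim_row B, j mod dim_col B)"
  by (simp add: kron_def)

lemma kron_mult:
  assumes "A \<in> carrier_mat a b" "B \<in> carrier_mat a' b'" "C \<in> carrier_mat b c" "D \<in> carrier_mat b' c'"
  shows "kron A B * kron C D = kron (A * C) (B * D)"
proof (rule eq_matI)
  fix i j assume "i < dim_row (kron (A * C) (B * D))" "j < dim_col (kron (A * C) (B * D))"
  then have ij: "i < a * a'" "j < c * c'" using assms by auto
  note dm = div_mod_less[OF ij(1)] div_mod_less[OF ij(2)]
  have "(kron A B * kron C D) $$ (i, j) = (\<Sum>k<b * b'. kron A B $$ (i, k) * kron C D $$ (k, j))"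
    using ij assms by (subst mult_mat_index) auto
  also have "\<dots> = (\<Sum>k<b * b'. (\<lambda>p q. (A $$ (i div a', p) * B $$ (i mod a', q)) *
      (C $$ (p, j div c') * D $$ (q, j mod c'))) (k div b') (k mod b'))"
    using ij assms by (intro sum.cong) (auto simp: kron_index)
  also have "\<dots> = (\<Sum>p<b. \<Sum>q<b'. (A $$ (i div a', p) * B $$ (i mod a', q)) *
      (C $$ (p, j div c') * D $$ (q, j mod c')))"
    by (rule sum_lessThan_div_mod)
  also have "\<dots> = (\<Sum>p<b. A $$ (i div a', p) * C $$ (p, j div c')) * (\<Sum>q<b'. B $$ (i mod a', q) * D $$ (q, j mod c'))"
    by (simp add: sum_product mult_ac)
  also have "\<dots> = (A * C) $$ (i div a', j div c') * (B * D) $$ (i mod a', j mod c')"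
    using assms dm by (simp add: mult_mat_index del: index_mult_mat(1))
  also have "\<dots> = kron (A * C) (B * D) $$ (i, j)"
    using ij assms by (simp add: kron_index del: index_mult_mat(1))
  finally show "(kron A B * kron C D) $$ (i, j) = kron (A * C) (B * D) $$ (i, j)" .
qed (use assms in auto)

lemma kron_adjoint: "mat_adjoint (kron A B) = kron (mat_adjoint A) (mat_adjoint B)"
  by (intro eq_matI) (auto simp: kron_index div_mod_less)

lemma kron_one: "kron (1\<^sub>m a) (1\<^sub>m b) = 1\<^sub>m (a * b)"
proof (rule eq_matI)
  fix i j assume "i < dim_row (1\<^sub>m (a * b))" "j < dim_col (1\<^sub>m (a * b))"
  then have "i < a * b" "j < a * b" by auto
  moreover have "(i div b = j div b \<and> i mod b = j mod b) = (i = j)"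
    by (metis div_mult_mod_eq)
  ultimately show "kron (1\<^sub>m a) (1\<^sub>m b) $$ (i, j) = 1\<^sub>m (a * b) $$ (i, j)"
    by (auto simp: kron_index div_mod_less)
qed auto

lemma mat_tr_kron:
  assumes "A \<in> carrier_mat a a" "B \<in> carrier_mat b b"
  shows "mat_tr (kron A B) = mat_tr A * mat_tr B"
proof -
  have "mat_tr (kron A B) = (\<Sum>k<a * b. (\<lambda>i j. A $$ (i, i) * B $$ (j, j)) (k div b) (k mod b))"
    using assms by (auto simp: mat_tr_def kron_index)
  also have "\<dots> = (\<Sum>i<a. \<Sum>j<b. A $$ (i, i) * B $$ (j, j))"
    by (rule sum_lessThan_div_mod)
  also have "\<dots> = mat_tr A * mat_tr B"
    using assms by (auto simp: mat_tr_def sum_product)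
  finally show ?thesis .
qed

lemma tensor_power_carrier [simp]:
  "A \<in> carrier_mat a b \<Longrightarrow> tensor_power A n \<in> carrier_mat (a ^ n) (b ^ n)"
  by (induction n) auto

lemma tensor_power_mult:
  assumes "A \<in> carrier_mat a b" "B \<in> carrier_mat b c"
  shows "tensor_power A n * tensor_power B n = tensor_power (A * B) n"
proof (induction n)
  case (Suc n)
  have "tensor_power A (Suc n) * tensor_power B (Suc n)
      = kron (A * B) (tensor_power A n * tensor_power B n)"
    using assms by (simp add: kron_mult[OF _ tensor_power_carrier _ tensor_power_carrier])
  then show ?case using Suc by simp
qed auto

lemma tensor_power_adjoint: "mat_adjoint (tensor_power A n) = tensor_power (mat_adjoint A) n"
  by (induction n) (auto simp: kron_adjoint)

lemma tensor_power_one: "tensor_power (1\<^sub>m a) n = 1\<^sub>m (a ^ n)"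
  by (induction n) (auto simp: kron_one)

lemma mat_tr_tensor_power:
  assumes "A \<in> carrier_mat a a"
  shows "mat_tr (tensor_power A n) = mat_tr A ^ n"
proof (induction n)
  case (Suc n)
  then show ?case using mat_tr_kron[OF assms tensor_power_carrier[OF assms]] by simp
qed auto

section \<open>The spectral theorem for self-adjoint matrices\<close>

definition unitary_mat :: "nat \<Rightarrow> complex mat \<Rightarrow> bool" where
  "unitary_mat d U \<longleftrightarrow> U \<in> carrier_mat d d \<and> mat_adjoint U * U = 1\<^sub>m d"

text \<open>
  Real entries suffice for the spectra that occur below, and they let eigenvalues be compared by
  the order of the reals.
\<close>

definition real_diag :: "nat \<Rightarrow> (nat \<Rightarrow> real) \<Rightarrow> complex mat" where
  "real_diag d l = mat d d (\<lambda>(i, j). if i = j then of_real (l i) else 0)"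

lemma real_diag_carrier [simp]: "real_diag d l \<in> carrier_mat d d"
  by (simp add: real_diag_def)

lemma real_diag_adjoint [simp]: "mat_adjoint (real_diag d l) = real_diag d l"
  by (intro eq_matI) (auto simp: real_diag_def)

lemma real_diag_mult: "real_diag d l * real_diag d m = real_diag d (\<lambda>i. l i * m i)"
proof (rule eq_matI)
  fix i j assume "i < dim_row (real_diag d (\<lambda>i. l i * m i))" "j < dim_col (real_diag d (\<lambda>i. l i * m i))"
  then have ij: "i < d" "j < d" by (auto simp: real_diag_def)
  have "(real_diag d l * real_diag d m) $$ (i, j)
      = (\<Sum>k<d. if k = i then (if i = j then of_real (l i * m i) else 0) else 0)"
    by (intro trans[OF mult_mat_index] sum.cong) (use ij in \<open>auto simp: real_diag_def\<close>)
  then show "(real_diag d l * real_diag d m) $$ (i, j) = real_diag d (\<lambda>i. l i * m i) $$ (i, j)"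
    using ij by (simp add: real_diag_def)
qed (auto simp: real_diag_def)

lemma unitary_matD:
  assumes "unitary_mat d U"
  shows "U \<in> carrier_mat d d" "mat_adjoint U \<in> carrier_mat d d"
    "mat_adjoint U * U = 1\<^sub>m d" "U * mat_adjoint U = 1\<^sub>m d"
  using assms by (auto simp: unitary_mat_def intro!: mat_mult_left_right_inverse[of "mat_adjoint U"])

lemma unitary_mat_mult:
  assumes "unitary_mat d U" "unitary_mat d V"
  shows "unitary_mat d (U * V)"
proof -
  note u = unitary_matD[OF assms(1)] and v = unitary_matD[OF assms(2)]
  have "mat_adjoint (U * V) * (U * V) = mat_adjoint V * (mat_adjoint U * U) * V"
    using u(1,2) v(1,2) by (simp add: mat_adjoint_mult[OF u(1) v(1)] assoc_mult_mat[of _ d d _ d _ d] mult_carrier_mat[of _ d d])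
  then show ?thesis using u v by (simp add: unitary_mat_def)
qed

text \<open>
  Complete \<open>v\<close> to a basis, apply the Gram-Schmidt process, which keeps the first vector, and
  normalise the columns.
\<close>

lemma ex_unitary_first_column:
  fixes v :: "complex vec"
  assumes v: "v \<in> carrier_vec n" "v \<noteq> 0\<^sub>v n"
  obtains U c where "unitary_mat n U" "col U 0 = c \<cdot>\<^sub>v v"
proof -
  interpret cof_vec_space n "TYPE(complex)" .
  define ws where "ws = gram_schmidt n (basis_completion v)"
  note bc = basis_completion[OF v]
  have n: "n > 0" using v by (cases n) auto
  have ws: "corthogonal ws" "set ws \<subseteq> carrier_vec n" "length ws = n"
    using gram_schmidt_result[OF bc(2,4,5) ws_def] bc(6) by auto
  have "hd ws = hd (basis_completion v)"
    using bc(2,6) n gram_schmidt_hd[of "hd (basis_completion v)" "tl (basis_completion v)"]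
    unfolding ws_def by (cases "basis_completion v") auto
  then have ws0: "ws ! 0 = v" using bc(7) ws(3) n by (metis hd_conv_nth length_0_conv less_numeral_extra(3))
  have wsc: "ws ! i \<in> carrier_vec n" if "i < n" for i using ws that by auto
  define q where "q i = sqrt (Re (ws ! i \<bullet>c ws ! i))" for i
  have q: "complex_of_real (q i) * of_real (q i) = ws ! i \<bullet>c ws ! i" "q i > 0" if i: "i < n" for i
  proof -
    have "ws ! i \<bullet>c ws ! i \<ge> 0" using wsc[OF i] by auto
    moreover have "ws ! i \<bullet>c ws ! i \<noteq> 0" using corthogonalD[OF ws(1), of i i] i ws by auto
    ultimately have r: "Im (ws ! i \<bullet>c ws ! i) = 0" "Re (ws ! i \<bullet>c ws ! i) > 0"
      by (auto simp: less_eq_complex_def complex_eq_iff order_less_le)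
    then show "q i > 0" by (simp add: q_def)
    show "complex_of_real (q i) * of_real (q i) = ws ! i \<bullet>c ws ! i"
      using r by (simp add: q_def complex_eq_iff flip: of_real_mult)
  qed
  define U where "U = mat n n (\<lambda>(i, j). ws ! j $ i / of_real (q j))"
  have U: "U \<in> carrier_mat n n" by (simp add: U_def)
  have "mat_adjoint U * U = 1\<^sub>m n"
  proof (rule eq_matI)
    fix i j assume "i < dim_row (1\<^sub>m n)" "j < dim_col (1\<^sub>m n)"
    then have ij: "i < n" "j < n" by auto
    have "(mat_adjoint U * U) $$ (i, j) = (\<Sum>k<n. ws ! j $ k * cnj (ws ! i $ k)) / (of_real (q i) * of_real (q j))"
      using ij U by (subst mult_mat_index) (auto simp: U_def sum_divide_distrib mult_ac intro!: sum.cong)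
    also have "(\<Sum>k<n. ws ! j $ k * cnj (ws ! i $ k)) = ws ! j \<bullet>c ws ! i"
      using carrier_vecD[OF wsc[OF ij(1)]] carrier_vecD[OF wsc[OF ij(2)]]
      by (auto simp: scalar_prod_def lessThan_atLeast0 intro!: sum.cong)
    also have "\<dots> / (of_real (q i) * of_real (q j)) = 1\<^sub>m n $$ (i, j)"
      using corthogonalD[OF ws(1), of j i] ij ws q[of i] by (auto simp: simp flip: q(1))
    finally show "(mat_adjoint U * U) $$ (i, j) = 1\<^sub>m n $$ (i, j)" .
  qed (use U in auto)
  then have "unitary_mat n U" using U by (simp add: unitary_mat_def)
  moreover have "col U 0 = (1 / of_real (q 0)) \<cdot>\<^sub>v v"
    using ws0 n v by (intro eq_vecI) (auto simp: U_def)
  ultimately show thesis using that by blast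
qed

lemma self_adjointD:
  assumes "self_adjoint d A"
  shows "A \<in> carrier_mat d d" "mat_adjoint A = A"
  using assms by (auto simp: self_adjoint_def)

lemma self_adjoint_index:
  assumes "self_adjoint d A" "i < d" "j < d"
  shows "cnj (A $$ (i, j)) = A $$ (j, i)"
  using assms by (metis self_adjointD mat_adjoint_index carrier_matD)

lemma self_adjoint_conj:
  assumes "self_adjoint d A" "U \<in> carrier_mat d d"
  shows "self_adjoint d (mat_adjoint U * A * U)"
  using assms self_adjointD[OF assms(1)]
  by (auto simp: self_adjoint_def mat_adjoint_mult[of _ d d _ d] assoc_mult_mat[of _ d d _ d _ d] mult_carrier_mat[of _ d d])

lemma mult_block_diag:
  assumes "X \<in> carrier_mat n n" "Y \<in> carrier_mat n n" "E \<in> carrier_mat 1 1" "F \<in> carrier_mat 1 1"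
  shows "four_block_mat E (0\<^sub>m 1 n) (0\<^sub>m n 1) X
      * four_block_mat F (0\<^sub>m 1 n) (0\<^sub>m n 1) (Y :: complex mat)
      = four_block_mat (E * F) (0\<^sub>m 1 n) (0\<^sub>m n 1) (X * Y)"
proof -
  have z: "E * 0\<^sub>m 1 n = 0\<^sub>m 1 n" "0\<^sub>m n 1 * F = 0\<^sub>m n 1" "0\<^sub>m 1 n * Y = 0\<^sub>m 1 n" "X * 0\<^sub>m n 1 = 0\<^sub>m n 1"
     "0\<^sub>m 1 n * 0\<^sub>m n 1 = (0\<^sub>m 1 1 :: complex mat)" "0\<^sub>m n 1 * 0\<^sub>m 1 n = (0\<^sub>m n n :: complex mat)"
    using assms by auto
  have c: "E * F \<in> carrier_mat 1 1" "X * Y \<in> carrier_mat n n" using assms by auto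
  show ?thesis
    unfolding mult_four_block_mat[OF assms(3) zero_carrier_mat zero_carrier_mat assms(1) assms(4) zero_carrier_mat zero_carrier_mat assms(2)]
    unfolding z by (simp only: right_add_zero_mat[OF c(1)] left_add_zero_mat[OF c(2)] left_add_zero_mat[OF zero_carrier_mat])
qed

text \<open>
  Induction on the dimension. In an orthonormal basis that starts with an eigenvector, self-adjointness
  turns the zeros below the first diagonal entry into zeros to its right, so the matrix splits into
  a real \<open>1 \<times> 1\<close> block and a smaller self-adjoint block.
\<close>

theorem spectral_theorem:
  assumes "self_adjoint d A"
  obtains U l where "unitary_mat d U" "A = U * real_diag d l * mat_adjoint U"
  using assms
proof (induction d arbitrary: A thesis)
  case 0
  show ?case
    by (rule "0.prems"(1)[of "1\<^sub>m 0" "\<lambda>_. 0"]) (use 0 in \<open>auto simp: unitary_mat_def self_adjoint_def real_diag_def\<close>)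
next
  case (Suc n)
  note A = self_adjointD[OF Suc.prems(2)]
  obtain e where "eigenvalue A e"
    using spectrum_non_empty[OF A(1)] by (auto simp: spectrum_def)
  then obtain v where v: "v \<in> carrier_vec (Suc n)" "v \<noteq> 0\<^sub>v (Suc n)" "A *\<^sub>v v = e \<cdot>\<^sub>v v"
    using A by (auto simp: eigenvalue_def eigenvector_def)
  obtain U c where U: "unitary_mat (Suc n) U" and c: "col U 0 = c \<cdot>\<^sub>v v"
    using ex_unitary_first_column[OF v(1,2)] .
  note u = unitary_matD[OF U]
  define A' where "A' = mat_adjoint U * A * U"
  have sa': "self_adjoint (Suc n) A'" unfolding A'_def
    by (rule self_adjoint_conj[OF Suc.prems(2) u(1)])
  note A' = self_adjointD[OF sa']
  have AU: "A = U * A' * mat_adjoint U"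
  proof -
    have "U * A' * mat_adjoint U = (U * mat_adjoint U) * A * (U * mat_adjoint U)"
      unfolding A'_def using u(1,2) A(1)
      by (simp add: assoc_mult_mat[of _ "Suc n" "Suc n" _ "Suc n" _ "Suc n"] mult_carrier_mat[of _ "Suc n" "Suc n"])
    then show ?thesis using u A by simp
  qed
  have col0: "A' $$ (i, 0) = (if i = 0 then e else 0)" if i: "i < Suc n" for i
  proof -
    have "A' $$ (i, 0) = (mat_adjoint U * (A * U)) $$ (i, 0)"
      unfolding A'_def using u A by (simp add: assoc_mult_mat[of _ "Suc n" "Suc n" _ "Suc n" _ "Suc n"])
    also have "\<dots> = row (mat_adjoint U) i \<bullet> col (A * U) 0"
      using i u A by simp
    also have "col (A * U) 0 = A *\<^sub>v col U 0" using A u by auto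
    also have "\<dots> = e \<cdot>\<^sub>v col U 0"
      using v A by (simp add: c mult_mat_vec[OF A(1) v(1)] smult_smult_assoc mult.commute)
    also have "row (mat_adjoint U) i \<bullet> \<dots> = e * (row (mat_adjoint U) i \<bullet> col U 0)"
      using carrier_matD[OF u(1)] by (intro scalar_prod_smult_distrib[of _ "Suc n"] carrier_vecI) auto
    also have "row (mat_adjoint U) i \<bullet> col U 0 = (mat_adjoint U * U) $$ (i, 0)"
      using i u(1) by simp
    also have "\<dots> = (if i = 0 then 1 else 0)" unfolding u(3) using i by simp
    finally show ?thesis by simp
  qed
  have e: "cnj e = e" using self_adjoint_index[OF sa', of 0 0] col0[of 0] by simp
  have row0: "A' $$ (0, j) = (if j = 0 then e else 0)" if "j < Suc n" for j
    using self_adjoint_index[OF sa', of j 0] col0[OF that] that e by (auto split: if_splits)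
  define B where "B = mat n n (\<lambda>(i, j). A' $$ (Suc i, Suc j))"
  have "self_adjoint n B"
    unfolding self_adjoint_def
    by (auto simp: B_def intro!: eq_matI self_adjoint_index[OF sa'])
  then obtain V l where V: "unitary_mat n V" and B: "B = V * real_diag n l * mat_adjoint V"
    using Suc.IH by blast
  note vv = unitary_matD[OF V]
  define W where "W = four_block_mat (1\<^sub>m 1) (0\<^sub>m 1 n) (0\<^sub>m n 1) V"
  define m where "m = case_nat (Re e) l"
  have W: "W \<in> carrier_mat (Suc n) (Suc n)" using vv by (auto simp: W_def)
  have Wadj: "mat_adjoint W = four_block_mat (1\<^sub>m 1) (0\<^sub>m 1 n) (0\<^sub>m n 1) (mat_adjoint V)"
    using vv(1) W by (intro eq_matI) (auto simp: W_def)
  have md: "real_diag (Suc n) m = four_block_mat (mat 1 1 (\<lambda>_. e)) (0\<^sub>m 1 n) (0\<^sub>m n 1) (real_diag n l)"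
    using e by (intro eq_matI) (auto simp: real_diag_def m_def complex_eq_iff split: nat.split)
  have A'b: "A' = four_block_mat (mat 1 1 (\<lambda>_. e)) (0\<^sub>m 1 n) (0\<^sub>m n 1) B"
    using A' col0 row0 by (intro eq_matI) (auto simp: B_def)
  have E: "mat 1 1 (\<lambda>_. e) \<in> carrier_mat 1 1" by simp
  have "mat_adjoint W * W = 1\<^sub>m (Suc n)"
    unfolding Wadj unfolding W_def
    unfolding mult_block_diag[OF vv(2,1) one_carrier_mat one_carrier_mat] vv(3) by simp
  then have uW: "unitary_mat (Suc n) W" using W by (simp add: unitary_mat_def)
  have VD: "V * real_diag n l \<in> carrier_mat n n" using vv(1) by simp
  have "W * real_diag (Suc n) m * mat_adjoint W = A'"
    unfolding Wadj A'b B unfolding W_def md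
    unfolding mult_block_diag[OF vv(1) real_diag_carrier one_carrier_mat E] left_mult_one_mat[OF E]
      mult_block_diag[OF VD vv(2) E one_carrier_mat] right_mult_one_mat[OF E] ..
  then have "A = U * (W * real_diag (Suc n) m * mat_adjoint W) * mat_adjoint U" using AU by simp
  also have "\<dots> = (U * W) * real_diag (Suc n) m * mat_adjoint (U * W)"
    using u(1,2) W by (simp add: mat_adjoint_mult[OF u(1) W] assoc_mult_mat[of _ "Suc n" "Suc n" _ "Suc n" _ "Suc n"] mult_carrier_mat[of _ "Suc n" "Suc n"])
  finally show ?case using Suc.prems(1) unitary_mat_mult[OF U uW] by blast
qed

section \<open>Positive matrices and the trace norm\<close>

lemma mult_mat_vec_index:
  assumes "A \<in> carrier_mat n m" "v \<in> carrier_vec m" "i < n"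
  shows "(A *\<^sub>v v) $ i = (\<Sum>j<m. A $$ (i, j) * v $ j)"
  using assms by (auto simp: scalar_prod_def lessThan_atLeast0 intro!: sum.cong)

lemma cscalar_prod_sum:
  fixes v w :: "complex vec"
  assumes "v \<in> carrier_vec n" "w \<in> carrier_vec n"
  shows "v \<bullet>c w = (\<Sum>i<n. v $ i * cnj (w $ i))"
  using assms by (auto simp: scalar_prod_def lessThan_atLeast0 intro!: sum.cong)

lemma quadratic_form_sum:
  fixes A :: "complex mat" and v :: "complex vec"
  assumes "A \<in> carrier_mat n n" "v \<in> carrier_vec n"
  shows "(A *\<^sub>v v) \<bullet>c v = (\<Sum>i<n. \<Sum>j<n. A $$ (i, j) * v $ j * cnj (v $ i))"
proof -
  have "(A *\<^sub>v v) \<bullet>c v = (\<Sum>i<n. (A *\<^sub>v v) $ i * cnj (v $ i))"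
    using assms by (intro cscalar_prod_sum) auto
  also have "\<dots> = (\<Sum>i<n. \<Sum>j<n. A $$ (i, j) * v $ j * cnj (v $ i))"
    by (intro sum.cong refl) (simp add: mult_mat_vec_index[OF assms] sum_distrib_right del: index_mult_mat_vec)
  finally show ?thesis .
qed

lemma cscalar_prod_adjoint:
  fixes A :: "complex mat"
  assumes "A \<in> carrier_mat n m" "x \<in> carrier_vec m" "y \<in> carrier_vec n"
  shows "(A *\<^sub>v x) \<bullet>c y = x \<bullet>c (mat_adjoint A *\<^sub>v y)"
proof -
  have "(A *\<^sub>v x) \<bullet>c y = (\<Sum>i<n. (A *\<^sub>v x) $ i * cnj (y $ i))"
    using assms by (intro cscalar_prod_sum) auto
  also have "\<dots> = (\<Sum>i<n. \<Sum>k<m. A $$ (i, k) * x $ k * cnj (y $ i))"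
    by (intro sum.cong refl) (simp add: mult_mat_vec_index[OF assms(1,2)] sum_distrib_right del: index_mult_mat_vec)
  also have "\<dots> = (\<Sum>k<m. x $ k * cnj (\<Sum>i<n. cnj (A $$ (i, k)) * y $ i))"
    by (subst sum.swap) (simp add: sum_distrib_left mult_ac)
  also have "\<dots> = (\<Sum>k<m. x $ k * cnj ((mat_adjoint A *\<^sub>v y) $ k))"
    using assms by (intro sum.cong refl) (subst mult_mat_vec_index[of _ m n], auto)
  also have "\<dots> = x \<bullet>c (mat_adjoint A *\<^sub>v y)"
    using assms mult_mat_vec_carrier[OF mat_adjoint_carrier[OF assms(1)] assms(3)]
    by (intro cscalar_prod_sum[symmetric]) auto
  finally show ?thesis .
qed

lemma psd_carrier: "psd d A \<Longrightarrow> A \<in> carrier_mat d d"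
  by (simp add: psd_def)

text \<open>
  Polarisation. The quadratic form is real at the vectors \<open>e\<^sub>i + c e\<^sub>j\<close>; the choices \<open>c = 1\<close> and
  \<open>c = \<i>\<close> give the imaginary and the real part of \<open>A\<^sub>i\<^sub>j = cnj A\<^sub>j\<^sub>i\<close>.
\<close>

lemma psd_self_adjoint:
  assumes "psd d A"
  shows "self_adjoint d A"
proof -
  note A = psd_carrier[OF assms]
  have form: "0 \<le> A $$ (i, i) + c * A $$ (i, j) + cnj c * A $$ (j, i) + c * cnj c * A $$ (j, j)"
    if ij: "i < d" "j < d" for i j c
  proof -
    define v where "v = vec d (\<lambda>k. (if k = i then 1 else 0) + (if k = j then c else 0))"
    have v: "v \<in> carrier_vec d" by (simp add: v_def)
    have "(A *\<^sub>v v) \<bullet>c v = (\<Sum>k<d. \<Sum>l<d. A $$ (k, l) * v $ l * cnj (v $ k))"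
      by (rule quadratic_form_sum[OF A v])
    also have "\<dots> = (\<Sum>k<d. (A $$ (k, i) + c * A $$ (k, j)) * cnj (v $ k))"
    proof (rule sum.cong[OF refl])
      fix k
      have "(\<Sum>l<d. A $$ (k, l) * v $ l * cnj (v $ k)) = (\<Sum>l<d. A $$ (k, l) * v $ l) * cnj (v $ k)"
        by (simp add: sum_distrib_right)
      also have "(\<Sum>l<d. A $$ (k, l) * v $ l) = (\<Sum>l<d. (if l = i then A $$ (k, l) else 0) + (if l = j then c * A $$ (k, l) else 0))"
        by (rule sum.cong) (auto simp: v_def algebra_simps)
      also have "\<dots> = A $$ (k, i) + c * A $$ (k, j)"
        using ij by (simp add: sum.distrib)
      finally show "(\<Sum>l<d. A $$ (k, l) * v $ l * cnj (v $ k)) = (A $$ (k, i) + c * A $$ (k, j)) * cnj (v $ k)" .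
    qed
    also have "\<dots> = (\<Sum>k<d. (if k = i then A $$ (k, i) + c * A $$ (k, j) else 0)
        + (if k = j then (A $$ (k, i) + c * A $$ (k, j)) * cnj c else 0))"
      by (rule sum.cong) (auto simp: v_def algebra_simps)
    also have "\<dots> = A $$ (i, i) + c * A $$ (i, j) + cnj c * A $$ (j, i) + c * cnj c * A $$ (j, j)"
      using ij by (simp add: sum.distrib algebra_simps)
    finally show ?thesis using assms v by (metis psd_def)
  qed
  have "mat_adjoint A = A"
  proof (rule eq_matI)
    fix i j assume "i < dim_row A" "j < dim_col A"
    then have ij: "i < d" "j < d" using A by auto
    have "Im (A $$ (i, i)) = 0" "Im (A $$ (j, j)) = 0"
      using form[of i i 0] form[of j j 0] ij by (auto simp: less_eq_complex_def)
    with form[OF ij, of 1] form[OF ij, of \<i>] show "mat_adjoint A $$ (i, j) = A $$ (i, j)"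
      using ij A by (auto simp: less_eq_complex_def complex_eq_iff)
  qed (use A in auto)
  then show ?thesis using A by (simp add: self_adjoint_def)
qed

lemma psd_gram:
  fixes R :: "complex mat"
  assumes "R \<in> carrier_mat n m"
  shows "psd n (R * mat_adjoint R)"
  unfolding psd_def
proof (intro conjI ballI)
  fix v :: "complex vec" assume v: "v \<in> carrier_vec n"
  have "(R * mat_adjoint R *\<^sub>v v) \<bullet>c v = (R *\<^sub>v (mat_adjoint R *\<^sub>v v)) \<bullet>c v"
    using assms v by (subst assoc_mult_mat_vec) auto
  also have "\<dots> = (mat_adjoint R *\<^sub>v v) \<bullet>c (mat_adjoint R *\<^sub>v v)"
    using assms v mult_mat_vec_carrier[OF mat_adjoint_carrier[OF assms] v]
    by (intro cscalar_prod_adjoint) auto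
  finally show "0 \<le> (R * mat_adjoint R *\<^sub>v v) \<bullet>c v"
    using conjugate_square_ge_0_vec by metis
qed (use assms in auto)

lemma conj_diag_index:
  fixes M W :: "complex mat"
  assumes "M \<in> carrier_mat n n" "W \<in> carrier_mat n m" "i < m"
  shows "(mat_adjoint W * M * W) $$ (i, i) = (M *\<^sub>v col W i) \<bullet>c col W i"
proof -
  have "(mat_adjoint W * M * W) $$ (i, i) = (mat_adjoint W * (M * W)) $$ (i, i)"
    using assms by (simp add: assoc_mult_mat[of _ m n _ n _ m])
  also have "\<dots> = (\<Sum>k<n. cnj (W $$ (k, i)) * (M * W) $$ (k, i))"
    using assms by (subst mult_mat_index) auto
  also have "\<dots> = (\<Sum>k<n. (M *\<^sub>v col W i) $ k * cnj (col W i $ k))"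
    using assms by (intro sum.cong) auto
  also have "\<dots> = (M *\<^sub>v col W i) \<bullet>c col W i"
    using assms by (intro cscalar_prod_sum[symmetric]) (auto intro!: carrier_vecI)
  finally show ?thesis .
qed

lemma psd_conj_diag_nonneg:
  assumes "psd n M" "W \<in> carrier_mat n m" "i < m"
  shows "0 \<le> (mat_adjoint W * M * W) $$ (i, i)"
  using assms conj_diag_index[OF psd_carrier[OF assms(1)] assms(2,3)] by (auto simp: psd_def)

lemma psd_conj_tr_nonneg:
  assumes "psd n M" "W \<in> carrier_mat n m"
  shows "0 \<le> mat_tr (mat_adjoint W * M * W)"
  using assms psd_conj_diag_nonneg[OF assms] by (auto simp: mat_tr_def intro!: sum_nonneg)

lemma unitary_conj_cancel:
  assumes "unitary_mat d U" "D \<in> carrier_mat d d"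
  shows "mat_adjoint U * (U * D * mat_adjoint U) * U = D"
proof -
  note u = unitary_matD[OF assms(1)]
  have "mat_adjoint U * (U * D * mat_adjoint U) * U = (mat_adjoint U * U) * D * (mat_adjoint U * U)"
    using u(1,2) assms(2)
    by (simp add: assoc_mult_mat[of _ d d _ d _ d] mult_carrier_mat[of _ d d])
  also have "\<dots> = D" unfolding u(3) using assms(2) by simp
  finally show ?thesis .
qed

lemma psd_spectral:
  assumes "psd d A"
  obtains U l where "unitary_mat d U" "A = U * real_diag d l * mat_adjoint U" "\<And>i. i < d \<Longrightarrow> 0 \<le> l i"
proof -
  obtain U l where U: "unitary_mat d U" and A: "A = U * real_diag d l * mat_adjoint U"
    using spectral_theorem[OF psd_self_adjoint[OF assms]] by blast
  note u = unitary_matD[OF U]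
  have "0 \<le> l i" if "i < d" for i
  proof -
    have "0 \<le> (mat_adjoint U * A * U) $$ (i, i)"
      by (rule psd_conj_diag_nonneg[OF assms u(1) that])
    then show ?thesis
      using that unfolding A unitary_conj_cancel[OF U real_diag_carrier] by (simp add: real_diag_def less_eq_complex_def)
  qed
  with U A show thesis using that by blast
qed

lemma unitary_diag_gram:
  assumes "unitary_mat d U" "\<And>i. i < d \<Longrightarrow> 0 \<le> l i"
  defines "R \<equiv> U * real_diag d (\<lambda>i. sqrt (l i))"
  shows "R \<in> carrier_mat d d" "R * mat_adjoint R = U * real_diag d l * mat_adjoint U"
proof -
  note u = unitary_matD[OF assms(1)]
  show "R \<in> carrier_mat d d" using u by (auto simp: R_def)
  have "real_diag d (\<lambda>i. sqrt (l i)) * real_diag d (\<lambda>i. sqrt (l i)) = real_diag d l"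
    using assms(2) unfolding real_diag_mult by (intro eq_matI) (auto simp: real_diag_def)
  moreover have "R * mat_adjoint R
      = U * (real_diag d (\<lambda>i. sqrt (l i)) * real_diag d (\<lambda>i. sqrt (l i))) * mat_adjoint U"
    unfolding R_def mat_adjoint_mult[OF u(1) real_diag_carrier] real_diag_adjoint
    using u(1,2) by (simp add: assoc_mult_mat[of _ d d _ d _ d] mult_carrier_mat[of _ d d])
  ultimately show "R * mat_adjoint R = U * real_diag d l * mat_adjoint U" by simp
qed

lemma psd_unitary_diag:
  assumes "unitary_mat d U" "\<And>i. i < d \<Longrightarrow> 0 \<le> l i"
  shows "psd d (U * real_diag d l * mat_adjoint U)"
proof -
  have "psd d (U * real_diag d (\<lambda>i. sqrt (l i)) * mat_adjoint (U * real_diag d (\<lambda>i. sqrt (l i))))"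
    by (intro psd_gram[of _ d d] unitary_diag_gram(1)) (use assms in auto)
  also have "U * real_diag d (\<lambda>i. sqrt (l i)) * mat_adjoint (U * real_diag d (\<lambda>i. sqrt (l i)))
      = U * real_diag d l * mat_adjoint U"
    by (intro unitary_diag_gram(2)) (use assms in auto)
  finally show ?thesis .
qed

lemma psd_factor:
  assumes "psd d A"
  obtains R where "R \<in> carrier_mat d d" "A = R * mat_adjoint R"
proof -
  obtain U l where "unitary_mat d U" "A = U * real_diag d l * mat_adjoint U" "\<And>i. i < d \<Longrightarrow> 0 \<le> l i"
    using psd_spectral[OF assms] by blast
  then show thesis using that unitary_diag_gram[of d U l] by simp
qed

lemma real_diag_mult_index:
  assumes "Z \<in> carrier_mat d d" "i < d" "j < d"
  shows "(real_diag d l * Z) $$ (i, j) = of_real (l i) * Z $$ (i, j)"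
    and "(Z * real_diag d l) $$ (i, j) = of_real (l j) * Z $$ (i, j)"
proof -
  have "(real_diag d l * Z) $$ (i, j) = (\<Sum>k<d. if k = i then of_real (l i) * Z $$ (i, j) else 0)"
    by (intro trans[OF mult_mat_index] sum.cong) (use assms in \<open>auto simp: real_diag_def\<close>)
  then show "(real_diag d l * Z) $$ (i, j) = of_real (l i) * Z $$ (i, j)" using assms by simp
  have "(Z * real_diag d l) $$ (i, j) = (\<Sum>k<d. if k = j then of_real (l j) * Z $$ (i, j) else 0)"
    by (intro trans[OF mult_mat_index] sum.cong) (use assms in \<open>auto simp: real_diag_def\<close>)
  then show "(Z * real_diag d l) $$ (i, j) = of_real (l j) * Z $$ (i, j)" using assms by simp
qed

lemma unitary_diag_square:
  assumes "unitary_mat d U"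
  shows "(U * real_diag d l * mat_adjoint U) * (U * real_diag d l * mat_adjoint U)
    = U * real_diag d (\<lambda>i. l i * l i) * mat_adjoint U"
proof -
  note u = unitary_matD[OF assms]
  have "(U * real_diag d l * mat_adjoint U) * (U * real_diag d l * mat_adjoint U)
    = U * real_diag d l * (mat_adjoint U * U) * real_diag d l * mat_adjoint U"
    using u(1,2) by (simp add: assoc_mult_mat[of _ d d _ d _ d] mult_carrier_mat[of _ d d])
  also have "\<dots> = U * (real_diag d l * real_diag d l) * mat_adjoint U"
    unfolding u(3)
    using u(1,2) by (simp add: assoc_mult_mat[of _ d d _ d _ d] mult_carrier_mat[of _ d d] left_mult_one_mat[of _ d d])
  finally show ?thesis by (simp add: real_diag_mult)
qed

text \<open>
  Both sides say that \<open>V\<^sup>* W\<close> intertwines the two diagonal matrices. Entrywise, this is a condition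
  on pairs of eigenvalues.
\<close>

lemma unitary_diag_eq_iff:
  assumes "unitary_mat d V" "unitary_mat d W"
  shows "V * real_diag d p * mat_adjoint V = W * real_diag d q * mat_adjoint W \<longleftrightarrow>
    real_diag d p * (mat_adjoint V * W) = (mat_adjoint V * W) * real_diag d q" (is "?P = ?Q \<longleftrightarrow> ?L = ?R")
proof
  note v = unitary_matD[OF assms(1)] and w = unitary_matD[OF assms(2)]
  note ac = assoc_mult_mat[of _ d d _ d _ d] mult_carrier_mat[of _ d d]
  {
    assume "?P = ?Q"
    then have "mat_adjoint V * ?P * W = mat_adjoint V * ?Q * W" by simp
    moreover have "mat_adjoint V * ?P * W = (mat_adjoint V * V) * (real_diag d p * (mat_adjoint V * W))"
      using v(1,2) w(1,2) by (simp add: ac)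
    moreover have "(mat_adjoint V * V) * (real_diag d p * (mat_adjoint V * W)) = ?L"
      unfolding v(3) by (intro left_mult_one_mat[of _ d d] mult_carrier_mat[of _ d d]) (use v w in auto)
    moreover have "mat_adjoint V * ?Q * W = ((mat_adjoint V * W) * real_diag d q) * (mat_adjoint W * W)"
      using v(1,2) w(1,2) by (simp add: ac)
    moreover have "((mat_adjoint V * W) * real_diag d q) * (mat_adjoint W * W) = ?R"
      unfolding w(3) by (intro right_mult_one_mat[of _ d d] mult_carrier_mat[of _ d d]) (use v w in auto)
    ultimately show "?L = ?R" by metis
  }
  {
    assume "?L = ?R"
    then have "V * ?L * mat_adjoint W = V * ?R * mat_adjoint W" by simp
    moreover have "V * ?L * mat_adjoint W = ?P * (W * mat_adjoint W)"
      using v(1,2) w(1,2) by (simp add: ac)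
    moreover have "?P * (W * mat_adjoint W) = ?P"
      unfolding w(4) by (intro right_mult_one_mat[of _ d d] mult_carrier_mat[of _ d d]) (use v w in auto)
    moreover have "V * ?R * mat_adjoint W = (V * mat_adjoint V) * ?Q"
      using v(1,2) w(1,2) by (simp add: ac)
    moreover have "(V * mat_adjoint V) * ?Q = ?Q"
      unfolding v(4) by (intro left_mult_one_mat[of _ d d] mult_carrier_mat[of _ d d]) (use v w in auto)
    ultimately show "?P = ?Q" by metis
  }
qed

text \<open>
  By \<open>unitary_diag_eq_iff\<close> the squares agree iff \<open>p\<^sub>i\<^sup>2 Z\<^sub>i\<^sub>j = q\<^sub>j\<^sup>2 Z\<^sub>i\<^sub>j\<close> for
  \<open>Z = V\<^sup>* W\<close>. As \<open>p\<^sub>i\<close> and \<open>q\<^sub>j\<close> are nonnegative, the squares can be dropped.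
\<close>

lemma psd_square_root_unique:
  assumes P: "psd d P" and Q: "psd d Q" and eq: "P * P = Q * Q"
  shows "P = Q"
proof -
  obtain V p where V: "unitary_mat d V" and Pe: "P = V * real_diag d p * mat_adjoint V" and p: "\<And>i. i < d \<Longrightarrow> 0 \<le> p i"
    using psd_spectral[OF P] by blast
  obtain W q where W: "unitary_mat d W" and Qe: "Q = W * real_diag d q * mat_adjoint W" and q: "\<And>i. i < d \<Longrightarrow> 0 \<le> q i"
    using psd_spectral[OF Q] by blast
  define Z where "Z = mat_adjoint V * W"
  have Z: "Z \<in> carrier_mat d d"
    using unitary_matD[OF V] unitary_matD[OF W] by (auto simp: Z_def mult_carrier_mat[of _ d d])
  have "real_diag d (\<lambda>i. p i * p i) * Z = Z * real_diag d (\<lambda>i. q i * q i)"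
    using eq unfolding Pe Qe unitary_diag_square[OF V] unitary_diag_square[OF W]
    by (simp add: unitary_diag_eq_iff[OF V W] Z_def)
  then have sq: "of_real (p i * p i) * Z $$ (i, j) = of_real (q j * q j) * Z $$ (i, j)" if "i < d" "j < d" for i j
    using real_diag_mult_index[OF Z that] by metis
  have "real_diag d p * Z = Z * real_diag d q"
  proof (rule eq_matI)
    fix i j assume "i < dim_row (Z * real_diag d q)" "j < dim_col (Z * real_diag d q)"
    then have ij: "i < d" "j < d" using Z by (auto simp: real_diag_def)
    have "Z $$ (i, j) = 0 \<or> p i = q j"
    proof (cases "Z $$ (i, j) = 0")
      case False
      then have "complex_of_real (p i * p i) = of_real (q j * q j)" using sq[OF ij] by simp
      then have "p i * p i = q j * q j" unfolding of_real_eq_iff .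
      then have "(p i)\<^sup>2 = (q j)\<^sup>2" by (simp add: power2_eq_square)
      then show ?thesis using p[OF ij(1)] q[OF ij(2)] by (simp add: power2_eq_iff_nonneg)
    qed simp
    then show "(real_diag d p * Z) $$ (i, j) = (Z * real_diag d q) $$ (i, j)"
      unfolding real_diag_mult_index[OF Z ij] by auto
  qed (use Z in \<open>auto simp: real_diag_def\<close>)
  then show ?thesis unfolding Pe Qe unitary_diag_eq_iff[OF V W] Z_def .
qed

lemma mat_tr_unitary_diag:
  assumes "unitary_mat d U"
  shows "mat_tr (U * real_diag d l * mat_adjoint U) = of_real (\<Sum>i<d. l i)"
proof -
  note u = unitary_matD[OF assms]
  have "mat_tr (U * real_diag d l * mat_adjoint U) = mat_tr (mat_adjoint U * (U * real_diag d l))"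
    using u by (intro mat_tr_comm[of _ d d]) auto
  also have "\<dots> = mat_tr ((mat_adjoint U * U) * real_diag d l)"
    using u(1,2) by (simp add: assoc_mult_mat[of _ d d _ d _ d])
  also have "\<dots> = of_real (\<Sum>i<d. l i)"
    using u by (simp add: mat_tr_def real_diag_def)
  finally show ?thesis .
qed

text \<open>
  Uniqueness of the square root identifies the absolute value defined by description with
  \<open>U \<bar>l\<bar> U\<^sup>*\<close>.
\<close>

lemma trace_norm_self_adjoint:
  assumes U: "unitary_mat d U" and X: "X = U * real_diag d l * mat_adjoint U"
  shows "trace_norm X = (\<Sum>i<d. \<bar>l i\<bar>)"
proof -
  note u = unitary_matD[OF U]
  have Xc: "X \<in> carrier_mat d d" using u by (auto simp: X)
  have Xa: "mat_adjoint X = X"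
    unfolding X mat_adjoint_mult[OF mult_carrier_mat[OF u(1) real_diag_carrier] u(2)]
      mat_adjoint_mult[OF u(1) real_diag_carrier] real_diag_adjoint mat_adjoint_adjoint
    using u(1,2) by (simp add: assoc_mult_mat[of _ d d _ d _ d] mult_carrier_mat[of _ d d])
  define P where "P = U * real_diag d (\<lambda>i. \<bar>l i\<bar>) * mat_adjoint U"
  have P: "psd d P" unfolding P_def by (rule psd_unitary_diag[OF U]) simp
  have PP: "P * P = mat_adjoint X * X"
    unfolding Xa unfolding P_def X unitary_diag_square[OF U] by simp
  have "mat_abs X = P"
    unfolding mat_abs_def
  proof (rule the_equality)
    show "psd (dim_col X) P \<and> P * P = mat_adjoint X * X" unfolding carrier_matD(2)[OF Xc] using P PP by blast
    show "Q = P" if "psd (dim_col X) Q \<and> Q * Q = mat_adjoint X * X" for Q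
      using psd_square_root_unique[OF conjunct1[OF that] , unfolded carrier_matD(2)[OF Xc], OF P]
        trans[OF conjunct2[OF that] PP[symmetric]] by blast
  qed
  then show ?thesis
    by (simp add: trace_norm_def P_def mat_tr_unitary_diag[OF U])
qed

lemma unitary_entry_le_one:
  assumes "unitary_mat d U" "i < d" "j < d"
  shows "cmod (U $$ (i, j)) \<le> 1"
proof -
  note u = unitary_matD[OF assms(1)]
  have "(mat_adjoint U * U) $$ (j, j) = (\<Sum>k<d. of_real ((cmod (U $$ (k, j)))\<^sup>2))"
    using assms u(1,2) by (subst mult_mat_index) (auto simp: complex_norm_square mult.commute simp del: of_real_power intro!: sum.cong)
  then have "complex_of_real 1 = of_real (\<Sum>k<d. (cmod (U $$ (k, j)))\<^sup>2)"
    using u(3) assms by simp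
  then have "(\<Sum>k<d. (cmod (U $$ (k, j)))\<^sup>2) = 1" unfolding of_real_eq_iff by simp
  moreover have "(cmod (U $$ (i, j)))\<^sup>2 \<le> (\<Sum>k<d. (cmod (U $$ (k, j)))\<^sup>2)"
    using assms by (intro member_le_sum) auto
  ultimately show ?thesis by (simp add: power_le_one_iff abs_square_le_1)
qed

text \<open>
  Each eigenvalue is the value of the quadratic form at a unit vector, whose coordinates are at
  most 1 in modulus. Together with \<open>entry_le_trace_norm\<close> this makes closeness in trace norm the same
  as closeness of all entries, up to constants.
\<close>

lemma trace_norm_le_entries:
  assumes "self_adjoint d X"
  shows "trace_norm X \<le> d * (\<Sum>j<d. \<Sum>k<d. cmod (X $$ (j, k)))"
proof -
  obtain U l where U: "unitary_mat d U" and X: "X = U * real_diag d l * mat_adjoint U"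
    using spectral_theorem[OF assms] by blast
  note u = unitary_matD[OF U] and Xc = self_adjointD(1)[OF assms]
  have "\<bar>l i\<bar> \<le> (\<Sum>j<d. \<Sum>k<d. cmod (X $$ (j, k)))" if i: "i < d" for i
  proof -
    have "complex_of_real (l i) = real_diag d l $$ (i, i)" using i by (simp add: real_diag_def)
    also have "\<dots> = (mat_adjoint U * X * U) $$ (i, i)"
      unfolding X unitary_conj_cancel[OF U real_diag_carrier] ..
    also have "\<dots> = (\<Sum>j<d. \<Sum>k<d. X $$ (j, k) * U $$ (k, i) * cnj (U $$ (j, i)))"
      using conj_diag_index[OF Xc u(1) i] quadratic_form_sum[OF Xc, of "col U i"] i u(1) by simp
    finally have "\<bar>l i\<bar> = cmod (\<Sum>j<d. \<Sum>k<d. X $$ (j, k) * U $$ (k, i) * cnj (U $$ (j, i)))"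
      by (metis norm_of_real)
    also have "\<dots> \<le> (\<Sum>j<d. \<Sum>k<d. cmod (X $$ (j, k)))"
    proof (intro order_trans[OF norm_sum] sum_mono order_trans[OF norm_sum])
      fix j k assume "j \<in> {..<d}" "k \<in> {..<d}"
      then have "cmod (U $$ (k, i)) * cmod (U $$ (j, i)) \<le> 1 * 1"
        using i by (intro mult_mono unitary_entry_le_one[OF U]) auto
      then show "cmod (X $$ (j, k) * U $$ (k, i) * cnj (U $$ (j, i))) \<le> cmod (X $$ (j, k))"
        by (simp add: norm_mult mult.assoc mult_left_le)
    qed
    finally show ?thesis .
  qed
  then have "(\<Sum>i<d. \<bar>l i\<bar>) \<le> (\<Sum>i<d. (\<Sum>j<d. \<Sum>k<d. cmod (X $$ (j, k))))"
    by (intro sum_mono) auto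
  then show ?thesis by (simp add: trace_norm_self_adjoint[OF U X])
qed

lemma unitary_diag_index:
  assumes U: "unitary_mat d U" and ij: "i < d" "j < d"
  shows "(U * real_diag d l * mat_adjoint U) $$ (i, j) = (\<Sum>k<d. of_real (l k) * (U $$ (i, k) * cnj (U $$ (j, k))))"
proof -
  note u = unitary_matD[OF U]
  have UD: "U * real_diag d l \<in> carrier_mat d d" using u by auto
  show ?thesis
    by (intro trans[OF mult_mat_index] sum.cong)
       (use ij u UD in \<open>auto simp: real_diag_mult_index(2)[OF u(1)] carrier_matD[OF real_diag_carrier] simp del: index_mult_mat(1)\<close>)
qed

lemma entry_le_trace_norm:
  assumes "self_adjoint d X" "j < d" "k < d"
  shows "cmod (X $$ (j, k)) \<le> trace_norm X"
proof -
  obtain U l where U: "unitary_mat d U" and X: "X = U * real_diag d l * mat_adjoint U"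
    using spectral_theorem[OF assms(1)] by blast
  note u = unitary_matD[OF U]
  have "X $$ (j, k) = (\<Sum>i<d. of_real (l i) * (U $$ (j, i) * cnj (U $$ (k, i))))"
    unfolding X by (rule unitary_diag_index[OF U assms(2,3)])
  also have "cmod \<dots> \<le> (\<Sum>i<d. \<bar>l i\<bar>)"
  proof (intro order_trans[OF norm_sum] sum_mono)
    fix i assume "i \<in> {..<d}"
    then have "cmod (U $$ (j, i)) * cmod (U $$ (k, i)) \<le> 1 * 1"
      using assms by (intro mult_mono unitary_entry_le_one[OF U]) auto
    then show "cmod (of_real (l i) * (U $$ (j, i) * cnj (U $$ (k, i)))) \<le> \<bar>l i\<bar>"
      by (simp add: norm_mult mult_left_le)
  qed
  finally show ?thesis by (simp add: trace_norm_self_adjoint[OF U X])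
qed

section \<open>Invariance of the rank under invertible factors\<close>

text \<open>
  \<open>K\<close> maps the column space of \<open>A\<close> bijectively onto that of \<open>K A\<close>.
\<close>

lemma rank_mult_invertible_left:
  fixes A K L :: "'a::field mat"
  assumes A: "A \<in> carrier_mat n m" and K: "K \<in> carrier_mat n n" "L \<in> carrier_mat n n" "L * K = 1\<^sub>m n"
  shows "vec_space.rank n (K * A) = vec_space.rank n A"
proof -
  interpret vec_space "TYPE('a)" n .
  define X where "X = span (set (cols A))"
  define Y where "Y = span (set (cols (K * A)))"
  have KA: "K * A \<in> carrier_mat n m" using A K by auto
  have X: "X = {y \<in> carrier_vec n. \<exists>x\<in>carrier_vec m. A *\<^sub>v x = y}"
    using col_space_eq[OF A] unfolding carrier_matD[OF A] X_def col_space_def .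
  have Y: "Y = {y \<in> carrier_vec n. \<exists>x\<in>carrier_vec m. (K * A) *\<^sub>v x = y}"
    using col_space_eq[OF KA] unfolding carrier_matD[OF KA] Y_def col_space_def .
  have cA: "set (cols A) \<subseteq> carrier_vec n" "set (cols (K * A)) \<subseteq> carrier_vec n"
    using A KA cols_dim by blast+
  have sX: "subspace class_ring X V" and sY: "subspace class_ring Y V"
    unfolding X_def Y_def using cA by (auto intro!: span_is_subspace)
  have Xc: "X \<subseteq> carrier_vec n" by (auto simp: X)
  have KX: "(*\<^sub>v) K ` X = Y"
  proof -
    have "(K * A) *\<^sub>v x = K *\<^sub>v (A *\<^sub>v x)" if "x \<in> carrier_vec m" for x
      using A K that by (intro assoc_mult_mat_vec)
    then show ?thesis unfolding X Y using A K by (auto simp: image_iff)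
  qed
  have inj: "inj_on ((*\<^sub>v) K) (carrier_vec n)"
  proof (rule inj_on_inverseI[of _ "(*\<^sub>v) L"])
    fix x :: "'a vec" assume "x \<in> carrier_vec n"
    then show "L *\<^sub>v (K *\<^sub>v x) = x" using K by (simp flip: assoc_mult_mat_vec)
  qed
  have vX: "vectorspace class_ring (vs X)" "vectorspace class_ring (vs Y)"
    using sX sY subspace_is_vs by auto
  have lin: "linear_map class_ring (vs X) (vs Y) ((*\<^sub>v) K)"
    unfolding linear_map_def mod_hom_def mod_hom_axioms_def module_hom_def
    using vX Xc KX K
    by (auto simp: vectorspace_def mult_add_distrib_mat_vec[of K n n] mult_mat_vec[of K n n] subset_iff image_subset_iff)
  have fd: "vectorspace.fin_dim class_ring (vs X)"
    unfolding X_def using A by (rule fin_dim_span_cols)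
  have "vectorspace.dim class_ring (vs X) = vectorspace.dim class_ring (vs Y)"
    by (rule linear_map.dim_eq[OF lin fd]) (use inj Xc KX in \<open>auto intro: inj_on_subset\<close>)
  then show ?thesis unfolding rank_def X_def Y_def by simp
qed

text \<open>
  The two column spaces coincide.
\<close>

lemma rank_mult_invertible_right:
  fixes A K L :: "'a::field mat"
  assumes A: "A \<in> carrier_mat n m" and K: "K \<in> carrier_mat m m" "L \<in> carrier_mat m m" "K * L = 1\<^sub>m m"
  shows "vec_space.rank n (A * K) = vec_space.rank n A"
proof -
  interpret vec_space "TYPE('a)" n .
  have AK: "A * K \<in> carrier_mat n m" using A K by auto
  have X: "span (set (cols A)) = {y \<in> carrier_vec n. \<exists>x\<in>carrier_vec m. A *\<^sub>v x = y}"
    using col_space_eq[OF A] unfolding carrier_matD[OF A] col_space_def .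
  have Y: "span (set (cols (A * K))) = {y \<in> carrier_vec n. \<exists>x\<in>carrier_vec m. (A * K) *\<^sub>v x = y}"
    using col_space_eq[OF AK] unfolding carrier_matD[OF AK] col_space_def .
  have "\<exists>x\<in>carrier_vec m. (A * K) *\<^sub>v x = A *\<^sub>v y" if "y \<in> carrier_vec m" for y
  proof (rule bexI[of _ "L *\<^sub>v y"])
    have "K *\<^sub>v (L *\<^sub>v y) = (K * L) *\<^sub>v y"
      by (rule assoc_mult_mat_vec[symmetric]) (use K that in auto)
    also have "\<dots> = y" unfolding K(3) using that by simp
    finally have "K *\<^sub>v (L *\<^sub>v y) = y" .
    then show "(A * K) *\<^sub>v (L *\<^sub>v y) = A *\<^sub>v y"
      using assoc_mult_mat_vec[OF A K(1), of "L *\<^sub>v y"] K that by simp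
  qed (use K that in auto)
  moreover have "\<exists>x\<in>carrier_vec m. A *\<^sub>v x = (A * K) *\<^sub>v y" if "y \<in> carrier_vec m" for y
    using A K that by (intro bexI[of _ "K *\<^sub>v y"]) (simp_all add: assoc_mult_mat_vec[of _ n m _ m])
  ultimately have "span (set (cols (A * K))) = span (set (cols A))"
    unfolding X Y by fastforce
  then show ?thesis unfolding rank_def by simp
qed

lemma rank_conj_invertible:
  fixes A K L :: "'a::field mat"
  assumes A: "A \<in> carrier_mat n n" and K: "K \<in> carrier_mat n n" and det: "det K \<noteq> 0"
  shows "vec_space.rank n (K * A * K) = vec_space.rank n A"
proof -
  obtain L where L: "L \<in> carrier_mat n n" "L * K = 1\<^sub>m n" "K * L = 1\<^sub>m n"
    using det_non_zero_imp_unit[OF K det, of undefined] by (auto simp: Units_def ring_mat_def)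
  show ?thesis
    using rank_mult_invertible_right[of "K * A" n n K L] rank_mult_invertible_left[OF A K, of L] A K L by auto
qed

section \<open>Outcome laws and differences of mean values\<close>

text \<open>
  The hypothesis bounds the difference of \<open>p\<close> and \<open>q\<close> on every single event. On the level sets of a
  simple function these bounds combine by the Cauchy-Schwarz inequality for finite sums.
\<close>

lemma integral_difference_bound_simple:
  fixes f :: "'a \<Rightarrow> real"
  assumes fin: "finite_measure p" "finite_measure q" "finite_measure e"
    and sets: "sets q = sets p" "sets e = sets p"
    and bound: "\<And>B. B \<in> sets p \<Longrightarrow> (measure p B - measure q B)\<^sup>2 \<le> 2 * (measure p B + measure q B) * measure e B"
    and f: "simple_function p f"
  shows "\<bar>(\<integral>x. f x \<partial>p) - (\<integral>x. f x \<partial>q)\<bar>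
    \<le> sqrt (2 * ((\<integral>x. (f x)\<^sup>2 \<partial>p) + (\<integral>x. (f x)\<^sup>2 \<partial>q))) * sqrt (measure e (space e))"
proof -
  interpret p: finite_measure p by fact
  interpret q: finite_measure q by fact
  interpret e: finite_measure e by fact
  define Y where "Y = f ` space p"
  define A where "A y = f -` {y} \<inter> space p" for y
  have Y: "finite Y" using f by (auto simp: Y_def simple_function_def)
  have A: "A y \<in> sets p" for y
    unfolding A_def using simple_functionD(2)[OF f] by auto
  have Aq: "A y \<in> sets q" and Ae: "A y \<in> sets e" for y using A sets by auto
  have sp: "space q = space p" "space e = space p" by (rule sets_eq_imp_space_eq, rule sets)+
  have rep: "h (f x) = (\<Sum>y\<in>Y. h y * indicator (A y) x)" if "x \<in> space p" for x and h :: "real \<Rightarrow> real"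
  proof -
    have "(\<Sum>y\<in>Y. h y * indicator (A y) x) = (\<Sum>y\<in>Y. if y = f x then h y else 0)"
      using that by (intro sum.cong) (auto simp: A_def)
    then show ?thesis using that Y by (simp add: Y_def)
  qed
  have ip: "(\<integral>x. h (f x) \<partial>p) = (\<Sum>y\<in>Y. h y * measure p (A y))" for h :: "real \<Rightarrow> real"
  proof -
    have "(\<integral>x. h (f x) \<partial>p) = (\<integral>x. (\<Sum>y\<in>Y. h y * indicator (A y) x) \<partial>p)"
      by (intro Bochner_Integration.integral_cong refl rep) auto
    also have "\<dots> = (\<Sum>y\<in>Y. h y * measure p (A y))"
      using A by (subst Bochner_Integration.integral_sum) (auto simp: p.emeasure_eq_measure)
    finally show ?thesis .
  qed
  have iq: "(\<integral>x. h (f x) \<partial>q) = (\<Sum>y\<in>Y. h y * measure q (A y))" for h :: "real \<Rightarrow> real"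
  proof -
    have "(\<integral>x. h (f x) \<partial>q) = (\<integral>x. (\<Sum>y\<in>Y. h y * indicator (A y) x) \<partial>q)"
      by (intro Bochner_Integration.integral_cong refl rep) (auto simp: sp)
    also have "\<dots> = (\<Sum>y\<in>Y. h y * measure q (A y))"
      using Aq by (subst Bochner_Integration.integral_sum) (auto simp: q.emeasure_eq_measure)
    finally show ?thesis .
  qed
  have esum: "(\<Sum>y\<in>Y. measure e (A y)) \<le> measure e (space e)"
  proof -
    have "(\<Sum>y\<in>Y. measure e (A y)) = measure e (\<Union>y\<in>Y. A y)"
      using Y Ae by (intro e.finite_measure_finite_Union[symmetric]) (auto simp: disjoint_family_on_def A_def)
    then show ?thesis using e.bounded_measure by simp
  qed
  have "\<bar>(\<integral>x. f x \<partial>p) - (\<integral>x. f x \<partial>q)\<bar> = \<bar>\<Sum>y\<in>Y. y * (measure p (A y) - measure q (A y))\<bar>"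
    using ip[of "\<lambda>y. y"] iq[of "\<lambda>y. y"] by (simp add: sum_subtractf algebra_simps)
  also have "\<dots> \<le> (\<Sum>y\<in>Y. \<bar>y * (measure p (A y) - measure q (A y))\<bar>)" by (rule sum_abs)
  also have "\<dots> \<le> (\<Sum>y\<in>Y. sqrt (2 * (y\<^sup>2 * measure p (A y) + y\<^sup>2 * measure q (A y))) * sqrt (measure e (A y)))"
  proof (rule sum_mono)
    fix y assume "y \<in> Y"
    have "(y * (measure p (A y) - measure q (A y)))\<^sup>2 = y\<^sup>2 * (measure p (A y) - measure q (A y))\<^sup>2"
      by (simp add: power_mult_distrib)
    also have "\<dots> \<le> y\<^sup>2 * (2 * (measure p (A y) + measure q (A y)) * measure e (A y))"
      by (intro mult_left_mono bound A) auto
    also have "\<dots> = 2 * (y\<^sup>2 * measure p (A y) + y\<^sup>2 * measure q (A y)) * measure e (A y)"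
      by (simp add: algebra_simps)
    finally have "\<bar>y * (measure p (A y) - measure q (A y))\<bar>
        \<le> sqrt (2 * (y\<^sup>2 * measure p (A y) + y\<^sup>2 * measure q (A y)) * measure e (A y))"
      by (intro real_le_rsqrt) simp
    then show "\<bar>y * (measure p (A y) - measure q (A y))\<bar>
        \<le> sqrt (2 * (y\<^sup>2 * measure p (A y) + y\<^sup>2 * measure q (A y))) * sqrt (measure e (A y))"
      by (simp add: real_sqrt_mult)
  qed
  also have "\<dots> \<le> sqrt (\<Sum>y\<in>Y. (sqrt (2 * (y\<^sup>2 * measure p (A y) + y\<^sup>2 * measure q (A y))))\<^sup>2)
      * sqrt (\<Sum>y\<in>Y. (sqrt (measure e (A y)))\<^sup>2)"
    by (rule order_trans[OF real_le_rsqrt[OF Cauchy_Schwarz_ineq_sum]]) (simp only: real_sqrt_mult order_refl)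
  also have "(\<Sum>y\<in>Y. (sqrt (2 * (y\<^sup>2 * measure p (A y) + y\<^sup>2 * measure q (A y))))\<^sup>2)
      = 2 * ((\<integral>x. (f x)\<^sup>2 \<partial>p) + (\<integral>x. (f x)\<^sup>2 \<partial>q))"
    unfolding ip[of "\<lambda>y. y\<^sup>2"] iq[of "\<lambda>y. y\<^sup>2"] by (simp add: sum.distrib sum_distrib_left)
  also have "sqrt (\<Sum>y\<in>Y. (sqrt (measure e (A y)))\<^sup>2) \<le> sqrt (measure e (space e))"
    using esum by simp
  finally show ?thesis
    by (auto simp: mult_left_mono integral_nonneg_AE)
qed

text \<open>
  Square integrable functions are limits of simple functions that they dominate up to a factor 2, so
  both sides of the previous bound converge.
\<close>

lemma integral_difference_bound:
  fixes f :: "'a \<Rightarrow> real"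
  assumes fin: "finite_measure p" "finite_measure q" "finite_measure e"
    and sets: "sets q = sets p" "sets e = sets p"
    and bound: "\<And>B. B \<in> sets p \<Longrightarrow> (measure p B - measure q B)\<^sup>2 \<le> 2 * (measure p B + measure q B) * measure e B"
    and f: "f \<in> borel_measurable p"
    and int: "integrable p (\<lambda>x. (f x)\<^sup>2)" "integrable q (\<lambda>x. (f x)\<^sup>2)"
  shows "\<bar>(\<integral>x. f x \<partial>p) - (\<integral>x. f x \<partial>q)\<bar>
    \<le> sqrt (2 * ((\<integral>x. (f x)\<^sup>2 \<partial>p) + (\<integral>x. (f x)\<^sup>2 \<partial>q))) * sqrt (measure e (space e))"
proof -
  obtain s where s: "\<And>i. simple_function p (s i)" "\<And>x. x \<in> space p \<Longrightarrow> (\<lambda>i. s i x) \<longlonglongrightarrow> f x"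
    "\<And>i x. x \<in> space p \<Longrightarrow> norm (s i x) \<le> 2 * norm (f x)"
    using borel_measurable_implies_sequence_metric[OF f, of 0] unfolding dist_0_norm real_norm_def dist_real_def
    by (metis diff_zero)
  have sp: "space q = space p" by (rule sets_eq_imp_space_eq, rule sets)
  have dom: "(\<lambda>i. \<integral>x. s i x \<partial>m) \<longlonglongrightarrow> (\<integral>x. f x \<partial>m)" "(\<lambda>i. \<integral>x. (s i x)\<^sup>2 \<partial>m) \<longlonglongrightarrow> (\<integral>x. (f x)\<^sup>2 \<partial>m)"
    if m: "finite_measure m" "sets m = sets p" "space m = space p" "integrable m (\<lambda>x. (f x)\<^sup>2)" for m
  proof -
    interpret m: finite_measure m by fact
    have fm: "f \<in> borel_measurable m" using f m(2) by (simp cong: measurable_cong_sets)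
    have sm: "s i \<in> borel_measurable m" for i
      using borel_measurable_simple_function[OF s(1)] m(2) by (simp cong: measurable_cong_sets)
    \<comment> \<open>on a finite measure, square integrability provides an integrable bound for the function itself\<close>
    have b: "2 * \<bar>y\<bar> \<le> 1 + y\<^sup>2" for y :: real
      using zero_le_power2[of "1 - \<bar>y\<bar>"] by (simp add: power2_diff)
    have i1: "integrable m (\<lambda>x. 2 * norm (f x))"
      using fm b by (intro Bochner_Integration.integrable_bound[OF Bochner_Integration.integrable_add[OF m.integrable_const[of 1] m(4)]] AE_I2) auto
    have i2: "integrable m (\<lambda>x. 4 * (f x)\<^sup>2)" using m(4) by simp
    show "(\<lambda>i. \<integral>x. s i x \<partial>m) \<longlonglongrightarrow> (\<integral>x. f x \<partial>m)"
      by (rule integral_dominated_convergence[OF fm sm i1]) (use s m(3) in auto)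
    show "(\<lambda>i. \<integral>x. (s i x)\<^sup>2 \<partial>m) \<longlonglongrightarrow> (\<integral>x. (f x)\<^sup>2 \<partial>m)"
    proof (rule integral_dominated_convergence[OF _ _ i2])
      show "AE x in m. (\<lambda>i. (s i x)\<^sup>2) \<longlonglongrightarrow> (f x)\<^sup>2"
        using s(2) m(3) by (intro AE_I2 tendsto_power) auto
      fix i
      show "AE x in m. norm ((s i x)\<^sup>2) \<le> 4 * (f x)\<^sup>2"
      proof (rule AE_I2)
        fix x assume "x \<in> space m"
        then have "\<bar>s i x\<bar> \<le> \<bar>2 * f x\<bar>" using s(3)[of x i] m(3) by simp
        then have "(s i x)\<^sup>2 \<le> (2 * f x)\<^sup>2" by (simp only: abs_le_square_iff)
        then show "norm ((s i x)\<^sup>2) \<le> 4 * (f x)\<^sup>2" by (simp add: power_mult_distrib)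
      qed
    qed (use fm sm in auto)
  qed
  note P = dom[OF fin(1) refl refl int(1)] and Q = dom[OF fin(2) sets(1) sp int(2)]
  show ?thesis
  proof (rule tendsto_le[OF sequentially_bot])
    show "(\<lambda>i. sqrt (2 * ((\<integral>x. (s i x)\<^sup>2 \<partial>p) + (\<integral>x. (s i x)\<^sup>2 \<partial>q))) * sqrt (measure e (space e)))
      \<longlonglongrightarrow> sqrt (2 * ((\<integral>x. (f x)\<^sup>2 \<partial>p) + (\<integral>x. (f x)\<^sup>2 \<partial>q))) * sqrt (measure e (space e))"
      by (intro tendsto_intros P Q)
    show "(\<lambda>i. \<bar>(\<integral>x. s i x \<partial>p) - (\<integral>x. s i x \<partial>q)\<bar>) \<longlonglongrightarrow> \<bar>(\<integral>x. f x \<partial>p) - (\<integral>x. f x \<partial>q)\<bar>"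
      by (intro tendsto_intros P Q)
    show "\<forall>\<^sub>F i in sequentially. \<bar>(\<integral>x. s i x \<partial>p) - (\<integral>x. s i x \<partial>q)\<bar>
      \<le> sqrt (2 * ((\<integral>x. (s i x)\<^sup>2 \<partial>p) + (\<integral>x. (s i x)\<^sup>2 \<partial>q))) * sqrt (measure e (space e))"
      by (intro always_eventually allI integral_difference_bound_simple[OF fin sets bound s(1)])
  qed
qed

text \<open>
  For a state \<open>W W\<^sup>*\<close> and an effect \<open>M\<close> this is the probability given by the Born rule. Here \<open>W\<close>
  is any matrix, so that differences of two such factors can be inserted.
\<close>

definition born :: "complex mat \<Rightarrow> complex mat \<Rightarrow> real" where
  "born M W = Re (mat_tr (mat_adjoint W * M * W))"

lemma born_nonneg:
  assumes "psd N M" "W \<in> carrier_mat N m"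
  shows "0 \<le> born M W"
  using psd_conj_tr_nonneg[OF assms] by (simp add: born_def less_eq_complex_def)

lemma born_line:
  assumes M: "M \<in> carrier_mat N N" and P: "P \<in> carrier_mat N m" and Q: "Q \<in> carrier_mat N m"
  shows "born M (P + of_real t \<cdot>\<^sub>m Q) = born M P
    + t * (Re (mat_tr (mat_adjoint P * M * Q)) + Re (mat_tr (mat_adjoint Q * M * P))) + t\<^sup>2 * born M Q"
proof -
  let ?t = "complex_of_real t"
  have adj: "mat_adjoint (P + ?t \<cdot>\<^sub>m Q) = mat_adjoint P + ?t \<cdot>\<^sub>m mat_adjoint Q"
    using P Q by (subst mat_adjoint_add[of _ N m]) (auto simp: mat_adjoint_smult)
  note Pa = mat_adjoint_carrier[OF P] and Qa = mat_adjoint_carrier[OF Q]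
  note PM = mult_carrier_mat[OF Pa M] and QM = mult_carrier_mat[OF Qa M]
  have "mat_adjoint (P + ?t \<cdot>\<^sub>m Q) * M * (P + ?t \<cdot>\<^sub>m Q)
    = (mat_adjoint P * M + ?t \<cdot>\<^sub>m (mat_adjoint Q * M)) * (P + ?t \<cdot>\<^sub>m Q)"
    unfolding adj using Pa Qa M
    by (simp add: add_mult_distrib_mat[of _ m N _ _ N] mult_smult_assoc_mat[OF Qa M])
  also have "\<dots> = (mat_adjoint P * M * P + ?t \<cdot>\<^sub>m (mat_adjoint Q * M * P))
      + (?t \<cdot>\<^sub>m (mat_adjoint P * M * Q) + ?t \<cdot>\<^sub>m (?t \<cdot>\<^sub>m (mat_adjoint Q * M * Q)))"
    using P Q PM QM
    by (simp add: add_mult_distrib_mat[of _ m N _ _ m] mult_add_distrib_mat[of _ m N _ m]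
      mult_smult_assoc_mat[OF QM P] mult_smult_assoc_mat[OF QM Q] mult_smult_distrib[OF PM Q]
      mult_smult_distrib[of "?t \<cdot>\<^sub>m (mat_adjoint Q * M)" m N Q m])
  finally show ?thesis
    unfolding born_def using mult_carrier_mat[OF PM P] mult_carrier_mat[OF PM Q] mult_carrier_mat[OF QM P] mult_carrier_mat[OF QM Q]
    by (simp add: mat_tr_add[of _ m] mat_tr_smult[of _ m] power2_eq_square algebra_simps)
qed

lemma nonneg_quadratic_discriminant:
  fixes x b z :: real
  assumes nn: "\<And>t. 0 \<le> x + t * b + t\<^sup>2 * z" and z: "0 \<le> z"
  shows "b\<^sup>2 \<le> 4 * x * z"
proof (cases "z = 0")
  case True
  have "b = 0"
  proof (rule ccontr)
    assume "b \<noteq> 0"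
    then show False using nn[of "- (x + 1) / b"] True by simp
  qed
  then show ?thesis using True by simp
next
  case False
  with z have z: "z > 0" by simp
  \<comment> \<open>the minimum of the quadratic polynomial\<close>
  have "0 \<le> 4 * z * (x + (- b / (2 * z)) * b + (- b / (2 * z))\<^sup>2 * z)"
    by (rule mult_nonneg_nonneg[OF _ nn]) (use z in simp)
  also have "\<dots> = 4 * x * z - b\<^sup>2" using z by (simp add: field_simps power2_eq_square)
  finally show ?thesis by simp
qed

text \<open>
  The Cauchy-Schwarz inequality for the positive form \<open>(P, Q) \<mapsto> Tr (P\<^sup>* M Q)\<close>, in the form of the
  discriminant of \<open>born M (P + t Q) = x + t b + t\<^sup>2 z\<close>. Since \<open>born M (P - Q) = x - b + z\<close>, the
  bound \<open>b\<^sup>2 \<le> 4 x z\<close> gives \<open>(x - z)\<^sup>2 \<le> (x + z)\<^sup>2 - b\<^sup>2 = (x - b + z) (x + b + z)\<close>, and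
  the last factor is at most \<open>2 (x + z)\<close>.
\<close>

lemma born_difference_bound:
  assumes M: "psd N M" and P: "P \<in> carrier_mat N m" and Q: "Q \<in> carrier_mat N m"
  shows "(born M P - born M Q)\<^sup>2 \<le> 2 * (born M P + born M Q) * born M (P - Q)"
proof -
  define b where "b = Re (mat_tr (mat_adjoint P * M * Q)) + Re (mat_tr (mat_adjoint Q * M * P))"
  have line: "born M (P + of_real t \<cdot>\<^sub>m Q) = born M P + t * b + t\<^sup>2 * born M Q" for t
    unfolding b_def by (rule born_line[OF psd_carrier[OF M] P Q])
  have "0 \<le> born M P + t * b + t\<^sup>2 * born M Q" for t
    unfolding line[symmetric] using P Q by (intro born_nonneg[OF M, of _ m]) auto
  then have disc: "b\<^sup>2 \<le> 4 * born M P * born M Q" using born_nonneg[OF M Q] by (rule nonneg_quadratic_discriminant)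
  have "P + of_real (- 1) \<cdot>\<^sub>m Q = P - Q" using P Q by (intro eq_matI) auto
  with line[of "-1"] have D: "born M (P - Q) = born M P - b + born M Q" by simp
  have "0 \<le> born M (P - Q)" using P Q by (intro born_nonneg[OF M, of _ m]) auto
  have "(born M P - born M Q)\<^sup>2 \<le> born M (P - Q) * (2 * (born M P + born M Q) - born M (P - Q))"
    using disc unfolding D by (simp add: power2_eq_square algebra_simps)
  also have "\<dots> \<le> born M (P - Q) * (2 * (born M P + born M Q))"
    using \<open>0 \<le> born M (P - Q)\<close> by (intro mult_left_mono) auto
  finally show ?thesis by (simp add: mult_ac)
qed

lemma povmD:
  assumes "povm N S M"
  shows "\<And>B. B \<in> sets S \<Longrightarrow> psd N (M B)" "M (space S) = 1\<^sub>m N"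
    "\<And>F i j. range F \<subseteq> sets S \<Longrightarrow> disjoint_family F \<Longrightarrow> i < N \<Longrightarrow> j < N \<Longrightarrow>
      (\<lambda>k. M (F k) $$ (i, j)) sums (M (\<Union>k. F k) $$ (i, j))"
  using assms by (auto simp: povm_def)

lemma mat_tr_mult_sum:
  assumes "R \<in> carrier_mat N N" "X \<in> carrier_mat N N"
  shows "mat_tr (R * X) = (\<Sum>i<N. \<Sum>k<N. R $$ (i, k) * X $$ (k, i))"
  using assms by (auto simp: mat_tr_def mult_mat_index simp del: index_mult_mat(1))

lemma born_eq_tr:
  assumes "W \<in> carrier_mat N m" "X \<in> carrier_mat N N"
  shows "Re (mat_tr (W * mat_adjoint W * X)) = born X W"
proof -
  note Wa = mat_adjoint_carrier[OF assms(1)]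
  have "mat_tr (W * mat_adjoint W * X) = mat_tr (W * (mat_adjoint W * X))"
    using assms Wa by (simp add: assoc_mult_mat[of _ N m _ N _ N])
  also have "\<dots> = mat_tr (mat_adjoint W * X * W)"
    using assms Wa by (intro mat_tr_comm[of _ N m]) auto
  finally show ?thesis by (simp add: born_def)
qed

text \<open>
  The law is given by \<open>measure_of\<close>, so its values become known only after countable
  additivity has been verified. Writing the state as \<open>W W\<^sup>*\<close> makes the probabilities visibly
  nonnegative.
\<close>

lemma
  assumes W: "W \<in> carrier_mat N m" and M: "povm N S M"
  defines "\<mu> \<equiv> outcome_law (W * mat_adjoint W) S M"
  shows sets_outcome_law: "sets \<mu> = sets S"
    and measure_outcome_law: "\<And>B. B \<in> sets S \<Longrightarrow> measure \<mu> B = born (M B) W"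
    and finite_measure_outcome_law: "finite_measure \<mu>"
proof -
  note Wa = mat_adjoint_carrier[OF W]
  have R: "W * mat_adjoint W \<in> carrier_mat N N" using W by auto
  have MB: "M B \<in> carrier_mat N N" if "B \<in> sets S" for B using povmD(1)[OF M that] by (rule psd_carrier)
  have sub: "sets S \<subseteq> Pow (space S)" by (rule sets.space_closed)
  show sets: "sets \<mu> = sets S"
    unfolding \<mu>_def outcome_law_def by (simp add: sub sets.sigma_sets_eq)
  have add: "(\<lambda>k. Re (mat_tr (W * mat_adjoint W * M (F k)))) sums Re (mat_tr (W * mat_adjoint W * M (\<Union>k. F k)))"
    if F: "range F \<subseteq> sets S" "disjoint_family F" for F
  proof -
    have U: "(\<Union>k. F k) \<in> sets S" using F by auto
    have Fk: "F k \<in> sets S" for k using F by auto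
    show ?thesis
      unfolding mat_tr_mult_sum[OF R MB[OF Fk]] mat_tr_mult_sum[OF R MB[OF U]]
      by (intro sums_Re sums_sum sums_mult povmD(3)[OF M F]) auto
  qed
  have nn: "0 \<le> Re (mat_tr (W * mat_adjoint W * M B))" if "B \<in> sets S" for B
    unfolding born_eq_tr[OF W MB[OF that]] by (rule born_nonneg[OF povmD(1)[OF M that] W])
  have "(\<lambda>k::nat. Re (mat_tr (W * mat_adjoint W * M {}))) sums Re (mat_tr (W * mat_adjoint W * M {}))"
    using add[of "\<lambda>_. {}"] by (auto simp: disjoint_family_on_def)
  then have empty: "Re (mat_tr (W * mat_adjoint W * M {})) = 0"
    using sums_summable summable_const_iff by blast
  have em: "emeasure \<mu> B = ennreal (Re (mat_tr (W * mat_adjoint W * M B)))" if "B \<in> sets S" for B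
  proof (rule emeasure_measure_of[of \<mu> "space S" "sets S"])
    show "\<mu> = measure_of (space S) (sets S) (\<lambda>B. ennreal (Re (mat_tr (W * mat_adjoint W * M B))))"
      by (simp add: \<mu>_def outcome_law_def)
    show "positive (sets \<mu>) (\<lambda>B. ennreal (Re (mat_tr (W * mat_adjoint W * M B))))"
      using empty by (simp add: positive_def)
    show "countably_additive (sets \<mu>) (\<lambda>B. ennreal (Re (mat_tr (W * mat_adjoint W * M B))))"
    proof (rule countably_additiveI)
      fix F :: "nat \<Rightarrow> _" assume F: "range F \<subseteq> sets \<mu>" "disjoint_family F"
      have s: "(\<lambda>k. Re (mat_tr (W * mat_adjoint W * M (F k)))) sums Re (mat_tr (W * mat_adjoint W * M (\<Union>k. F k)))"
        using F sets by (intro add) auto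
      have "(\<Sum>k. ennreal (Re (mat_tr (W * mat_adjoint W * M (F k)))))
          = ennreal (\<Sum>k. Re (mat_tr (W * mat_adjoint W * M (F k))))"
        using F sets s by (intro suminf_ennreal2 nn) (auto simp: sums_iff)
      then show "(\<Sum>k. ennreal (Re (mat_tr (W * mat_adjoint W * M (F k)))))
          = ennreal (Re (mat_tr (W * mat_adjoint W * M (\<Union> (range F)))))"
        using s by (simp add: sums_iff)
    qed
  qed (use sub that sets in auto)
  show "measure \<mu> B = born (M B) W" if "B \<in> sets S" for B
    using nn[OF that] by (simp add: measure_def em[OF that] born_eq_tr[OF W MB[OF that]])
  show "finite_measure \<mu>"
  proof
    have "space \<mu> = space S" by (rule sets_eq_imp_space_eq, rule sets)
    then show "emeasure \<mu> (space \<mu>) \<noteq> \<infinity>" using em[of "space S"] by simp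
  qed
qed

text \<open>
  The unnormalised law of the difference \<open>W - W'\<close> serves as the measure \<open>e\<close> in
  \<open>integral_difference_bound\<close>; its total mass is the squared Hilbert-Schmidt norm of \<open>W - W'\<close>.
\<close>

lemma outcome_law_mean_difference:
  assumes W: "W \<in> carrier_mat N m" and W': "W' \<in> carrier_mat N m" and M: "povm N S M"
  defines "p \<equiv> outcome_law (W * mat_adjoint W) S M" and "q \<equiv> outcome_law (W' * mat_adjoint W') S M"
  assumes f: "f \<in> borel_measurable S" and int: "integrable p (\<lambda>x. (f x)\<^sup>2)" "integrable q (\<lambda>x. (f x)\<^sup>2)"
  shows "\<bar>(\<integral>x. f x \<partial>p) - (\<integral>x. f x \<partial>q)\<bar>
    \<le> sqrt (2 * ((\<integral>x. (f x)\<^sup>2 \<partial>p) + (\<integral>x. (f x)\<^sup>2 \<partial>q)))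
      * sqrt (Re (mat_tr (mat_adjoint (W - W') * (W - W'))))"
proof -
  define e where "e = outcome_law ((W - W') * mat_adjoint (W - W')) S M"
  have D: "W - W' \<in> carrier_mat N m" using W W' by auto
  note Wp = sets_outcome_law[OF W M] measure_outcome_law[OF W M] finite_measure_outcome_law[OF W M]
  note Wq = sets_outcome_law[OF W' M] measure_outcome_law[OF W' M] finite_measure_outcome_law[OF W' M]
  note We = sets_outcome_law[OF D M] measure_outcome_law[OF D M] finite_measure_outcome_law[OF D M]
  have sets: "sets p = sets S" "sets q = sets S" "sets e = sets S"
    unfolding p_def q_def e_def by (rule Wp(1) Wq(1) We(1))+
  have me: "measure p B = born (M B) W" "measure q B = born (M B) W'" "measure e B = born (M B) (W - W')"
    if "B \<in> sets S" for B
    unfolding p_def q_def e_def by (rule Wp(2)[OF that] Wq(2)[OF that] We(2)[OF that])+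
  have "space e = space S" by (rule sets_eq_imp_space_eq, rule sets)
  then have es: "measure e (space e) = Re (mat_tr (mat_adjoint (W - W') * (W - W')))"
    using me(3)[of "space S"] povmD(2)[OF M] mat_adjoint_carrier[OF D] by (simp add: born_def right_mult_one_mat[of _ m])
  have "f \<in> borel_measurable p" using f sets(1) by (simp cong: measurable_cong_sets)
  then show ?thesis
    unfolding es[symmetric]
    by (intro integral_difference_bound[OF _ _ _ _ _ _ _ int])
       (use Wp(3) Wq(3) We(3) sets me povmD(1)[OF M] born_difference_bound[OF _ W W'] in \<open>auto simp: p_def q_def e_def\<close>)
qed

section \<open>A risk bound along a curve of states\<close>

text \<open>
  Cut \<open>[0, T]\<close> into \<open>k + 1\<close> equal steps. The quadratic error terms add up to \<open>O (1 / k)\<close> and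
  vanish in the limit.
\<close>

lemma chained_increment_bound:
  fixes g :: "real \<Rightarrow> real"
  assumes T: "0 \<le> T"
    and step: "\<And>s t. s \<in> {0..T} \<Longrightarrow> t \<in> {0..T} \<Longrightarrow> \<bar>g s - g t\<bar> \<le> (\<alpha> + C * \<bar>s - t\<bar>) * \<bar>s - t\<bar>"
  shows "\<bar>g T - g 0\<bar> \<le> \<alpha> * T"
proof -
  have main: "\<bar>g T - g 0\<bar> \<le> (\<alpha> + C * (T / real (Suc k))) * T" for k
  proof -
    define h where "h = T / real (Suc k)"
    have h: "0 \<le> h" "real (Suc k) * h = T" using T by (auto simp: h_def)
    have mem: "real i * h \<in> {0..T}" if "i \<le> Suc k" for i
      using h mult_right_mono[of "real i" "real (Suc k)" h] that by auto
    have "g T - g 0 = (\<Sum>i<Suc k. g (real (Suc i) * h) - g (real i * h))"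
      using h(2) by (subst sum_lessThan_telescope) simp
    also have "\<bar>\<dots>\<bar> \<le> (\<Sum>i<Suc k. \<bar>g (real (Suc i) * h) - g (real i * h)\<bar>)" by (rule sum_abs)
    also have "\<dots> \<le> (\<Sum>i<Suc k. (\<alpha> + C * h) * h)"
    proof (rule sum_mono)
      fix i assume "i \<in> {..<Suc k}"
      then have "real (Suc i) * h \<in> {0..T}" "real i * h \<in> {0..T}" by (auto intro!: mem simp del: of_nat_Suc atLeastAtMost_iff)
      from step[OF this] show "\<bar>g (real (Suc i) * h) - g (real i * h)\<bar> \<le> (\<alpha> + C * h) * h"
        using h(1) by (simp add: algebra_simps)
    qed
    also have "\<dots> = (\<alpha> + C * h) * (real (Suc k) * h)" by simp
    finally show ?thesis unfolding h(2) by (simp add: h_def)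
  qed
  have "(\<lambda>k. (\<alpha> + C * (T / real (Suc k))) * T) \<longlonglongrightarrow> (\<alpha> + C * (T * 0)) * T"
    unfolding divide_inverse by (intro tendsto_intros LIMSEQ_inverse_real_of_nat)
  then show ?thesis
    using main by (intro LIMSEQ_le_const[of _ "\<alpha> * T"]) auto
qed

lemma integrable_from_square:
  fixes f :: "'a \<Rightarrow> real"
  assumes "finite_measure M" "f \<in> borel_measurable M" "integrable M (\<lambda>x. (f x)\<^sup>2)"
  shows "integrable M f"
proof -
  interpret finite_measure M by fact
  have "\<bar>y\<bar> \<le> 1 + y\<^sup>2" for y :: real
    using zero_le_power2[of "1 - \<bar>y\<bar>"] by (simp add: power2_diff) 
  then show ?thesis
    using assms(2)
    by (intro Bochner_Integration.integrable_bound[OF Bochner_Integration.integrable_add[OF integrable_const[of 1] assms(3)]] AE_I2) auto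
qed

text \<open>
  The second moment about \<open>a\<close> controls the bias \<open>u = E x - a\<close>, and with it the second moment
  about any other point \<open>b\<close>.
\<close>

lemma shifted_second_moment:
  fixes a b r :: real
  assumes fin: "finite_measure M" and total: "measure M (space M) = 1"
    and m: "(\<lambda>x. x) \<in> borel_measurable M"
    and int: "integrable M (\<lambda>x. (x - a)\<^sup>2)" and r: "(\<integral>x. (x - a)\<^sup>2 \<partial>M) \<le> r"
  shows "\<bar>(\<integral>x. x \<partial>M) - a\<bar> \<le> sqrt r"
    and "integrable M (\<lambda>x. (x - b)\<^sup>2)"
    and "(\<integral>x. (x - b)\<^sup>2 \<partial>M) \<le> (sqrt r + \<bar>a - b\<bar>)\<^sup>2"
    and "(\<integral>x. x - b \<partial>M) = (\<integral>x. x \<partial>M) - b"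
proof -
  interpret finite_measure M by fact
  have i1: "integrable M (\<lambda>x. x - a)" by (rule integrable_from_square[OF fin _ int]) (use m in auto)
  have i0: "integrable M (\<lambda>x. x)"
    using Bochner_Integration.integrable_add[OF i1 integrable_const[of a]] by simp
  have mean: "(\<integral>x. x - c \<partial>M) = (\<integral>x. x \<partial>M) - c" for c
    using i0 total by simp
  then show "(\<integral>x. x - b \<partial>M) = (\<integral>x. x \<partial>M) - b" .
  define u where "u = (\<integral>x. x \<partial>M) - a"
  have sq: "integrable M (\<lambda>x. (x - c)\<^sup>2)" "(\<integral>x. (x - c)\<^sup>2 \<partial>M) = (\<integral>x. (x - a)\<^sup>2 \<partial>M) + 2 * (a - c) * u + (a - c)\<^sup>2" for c
  proof -
    have eq: "(\<lambda>x. (x - c)\<^sup>2) = (\<lambda>x. (x - a)\<^sup>2 + (2 * (a - c) * (x - a) + (a - c)\<^sup>2))"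
      by (rule ext) (simp add: power2_eq_square algebra_simps)
    have i2: "integrable M (\<lambda>x. 2 * (a - c) * (x - a))" using i1 by simp
    have i3: "integrable M (\<lambda>x. 2 * (a - c) * (x - a) + (a - c)\<^sup>2)"
      by (rule Bochner_Integration.integrable_add[OF i2 integrable_const])
    show "integrable M (\<lambda>x. (x - c)\<^sup>2)"
      using Bochner_Integration.integrable_add[OF int i3] unfolding eq[symmetric] .
    have "(\<integral>x. (x - c)\<^sup>2 \<partial>M) = (\<integral>x. (x - a)\<^sup>2 + (2 * (a - c) * (x - a) + (a - c)\<^sup>2) \<partial>M)"
      by (rule arg_cong[OF eq])
    also have "\<dots> = (\<integral>x. (x - a)\<^sup>2 \<partial>M) + (\<integral>x. 2 * (a - c) * (x - a) + (a - c)\<^sup>2 \<partial>M)"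
      by (rule Bochner_Integration.integral_add[OF int i3])
    also have "(\<integral>x. 2 * (a - c) * (x - a) + (a - c)\<^sup>2 \<partial>M)
        = (\<integral>x. 2 * (a - c) * (x - a) \<partial>M) + (\<integral>x. (a - c)\<^sup>2 \<partial>M)"
      by (rule Bochner_Integration.integral_add[OF i2 integrable_const])
    also have "(\<integral>x. 2 * (a - c) * (x - a) \<partial>M) = 2 * (a - c) * (\<integral>x. x - a \<partial>M)"
      by (rule integral_mult_right_zero)
    finally show "(\<integral>x. (x - c)\<^sup>2 \<partial>M) = (\<integral>x. (x - a)\<^sup>2 \<partial>M) + 2 * (a - c) * u + (a - c)\<^sup>2"
      using total unfolding mean u_def by simp
  qed
  show "integrable M (\<lambda>x. (x - b)\<^sup>2)" by (rule sq)
  \<comment> \<open>the second moment about the mean value \<open>a + u\<close> is the variance\<close>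
  have "0 \<le> (\<integral>x. (x - (a + u))\<^sup>2 \<partial>M)" by (intro integral_nonneg_AE) auto
  then have "u\<^sup>2 \<le> r" using r unfolding sq(2)[of "a + u"] by (simp add: power2_eq_square algebra_simps)
  then show u: "\<bar>(\<integral>x. x \<partial>M) - a\<bar> \<le> sqrt r" unfolding u_def by (simp add: real_le_rsqrt)
  have "0 \<le> r" using order_trans[OF zero_le_power2 \<open>u\<^sup>2 \<le> r\<close>] .
  have "(a - b) * u \<le> \<bar>a - b\<bar> * sqrt r"
    using u unfolding u_def by (metis abs_ge_self abs_mult abs_ge_zero mult_left_mono order_trans)
  then show "(\<integral>x. (x - b)\<^sup>2 \<partial>M) \<le> (sqrt r + \<bar>a - b\<bar>)\<^sup>2"
    unfolding sq(2)[of b] using r \<open>0 \<le> r\<close> by (simp add: power2_sum algebra_simps)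
qed

lemma square_integrable_of_risk:
  fixes M :: "real measure"
  assumes M: "sets M = sets borel" and risk: "(\<integral>\<^sup>+x. ennreal ((real n powr (1 / 2) * (x - a))\<^sup>2) \<partial>M) \<le> ennreal R"
    and n: "0 < n" and R: "0 \<le> R"
  shows "integrable M (\<lambda>x. (x - a)\<^sup>2)" "(\<integral>x. (x - a)\<^sup>2 \<partial>M) \<le> R / real n"
proof -
  have m: "(\<lambda>x. (x - a)\<^sup>2) \<in> borel_measurable M"
    using M by (simp cong: measurable_cong_sets)
  have eq: "(real n powr (1 / 2) * (x - a))\<^sup>2 = real n * (x - a)\<^sup>2" for x
    using n by (simp add: power_mult_distrib powr_half_sqrt)
  have "(\<integral>\<^sup>+x. ennreal ((real n powr (1 / 2) * (x - a))\<^sup>2) \<partial>M) = ennreal (real n) * (\<integral>\<^sup>+x. ennreal ((x - a)\<^sup>2) \<partial>M)"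
    unfolding eq using m by (subst nn_integral_cmult[symmetric]) (auto simp: ennreal_mult)
  then have le: "ennreal (real n) * (\<integral>\<^sup>+x. ennreal ((x - a)\<^sup>2) \<partial>M) \<le> ennreal R" using risk by simp
  have fin: "(\<integral>\<^sup>+x. ennreal ((x - a)\<^sup>2) \<partial>M) < \<infinity>"
  proof (rule ccontr)
    assume "\<not> ?thesis"
    then have "(\<integral>\<^sup>+x. ennreal ((x - a)\<^sup>2) \<partial>M) = \<infinity>" by (simp add: not_less top_unique)
    then show False using le n by (simp add: ennreal_mult_top top_unique)
  qed
  then show i: "integrable M (\<lambda>x. (x - a)\<^sup>2)"
    using m by (intro integrableI_nonneg) auto
  have "(\<integral>\<^sup>+x. ennreal ((x - a)\<^sup>2) \<partial>M) = ennreal (\<integral>x. (x - a)\<^sup>2 \<partial>M)"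
    by (rule nn_integral_eq_integral[OF i]) auto
  then have "ennreal (real n * (\<integral>x. (x - a)\<^sup>2 \<partial>M)) \<le> ennreal R"
    using le by (simp add: ennreal_mult)
  then have "real n * (\<integral>x. (x - a)\<^sup>2 \<partial>M) \<le> R" using R by simp
  then show "(\<integral>x. (x - a)\<^sup>2 \<partial>M) \<le> R / real n" using n by (simp add: field_simps)
qed

text \<open>
  On a step from \<open>s\<close> to \<open>t\<close> the outcome is centred at \<open>\<Psi> t\<close>. Its second moments under the two laws
  are \<open>R / n\<close> up to terms that vanish with \<open>\<bar>s - t\<bar>\<close>, hence its mean value moves by at most
  \<open>2 sqrt (R / n) sqrt n \<bar>s - t\<bar>\<close> to first order. Chaining gives \<open>2 sqrt R T\<close> in total, and the
  biases at the two ends add \<open>2 sqrt (R / n)\<close>.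
\<close>

lemma estimation_bound_along_curve:
  fixes W :: "real \<Rightarrow> complex mat" and \<Psi> :: "real \<Rightarrow> real"
  assumes M: "povm N borel M" and n: "0 < n" and T: "0 \<le> T" and R: "0 \<le> R"
    and W: "\<And>t. W t \<in> carrier_mat N m" and one: "\<And>t. mat_tr (mat_adjoint (W t) * W t) = 1"
    and dist: "\<And>s t. Re (mat_tr (mat_adjoint (W s - W t) * (W s - W t))) \<le> real n * (s - t)\<^sup>2"
    and lip: "\<And>s t. \<bar>\<Psi> s - \<Psi> t\<bar> \<le> L * \<bar>s - t\<bar>"
    and risk: "\<And>t. t \<in> {0..T} \<Longrightarrow>
      (\<integral>\<^sup>+x. ennreal ((real n powr (1 / 2) * (x - \<Psi> t))\<^sup>2) \<partial>outcome_law (W t * mat_adjoint (W t)) borel M) \<le> ennreal R"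
  shows "\<Psi> T - \<Psi> 0 \<le> 2 * sqrt R * (T + 1 / sqrt (real n))"
proof -
  define \<mu> where "\<mu> t = outcome_law (W t * mat_adjoint (W t)) borel M" for t
  define g where "g t = (\<integral>x. x \<partial>\<mu> t)" for t
  define r where "r = R / real n"
  have r0: "0 \<le> r" using R by (simp add: r_def)
  have L0: "0 \<le> L" using order_trans[OF abs_ge_zero lip[of 1 0]] by simp
  have sets: "sets (\<mu> t) = sets borel" for t
    unfolding \<mu>_def by (rule sets_outcome_law[OF W M])
  have sp: "space (\<mu> t) = UNIV" for t
    using sets_eq_imp_space_eq[OF sets] by simp
  have fin: "finite_measure (\<mu> t)" for t
    unfolding \<mu>_def by (rule finite_measure_outcome_law[OF W M])
  have total: "measure (\<mu> t) (space (\<mu> t)) = 1" for t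
    using one[of t] povmD(2)[OF M] mat_adjoint_carrier[OF W, of t]
    unfolding sp unfolding \<mu>_def
    by (subst measure_outcome_law[OF W M]) (auto simp: born_def right_mult_one_mat[of _ m])
  have meas: "(\<lambda>x. x) \<in> borel_measurable (\<mu> t)" for t
    using sets by (simp cong: measurable_cong_sets)
  have mom: "integrable (\<mu> t) (\<lambda>x. (x - \<Psi> t)\<^sup>2)" "(\<integral>x. (x - \<Psi> t)\<^sup>2 \<partial>\<mu> t) \<le> r"
    if "t \<in> {0..T}" for t
    using square_integrable_of_risk[OF sets risk[OF that, folded \<mu>_def] n R] unfolding r_def by auto
  have "\<bar>g s - g t\<bar> \<le> (2 * sqrt R + 2 * L * sqrt (real n) * \<bar>s - t\<bar>) * \<bar>s - t\<bar>"
    if st: "s \<in> {0..T}" "t \<in> {0..T}" for s t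
  proof -
    note S = shifted_second_moment(2-4)[OF fin total meas mom[OF st(1)], of "\<Psi> t"]
    note Tm = shifted_second_moment(2-4)[OF fin total meas mom[OF st(2)], of "\<Psi> t"]
    define h where "h = \<bar>s - t\<bar>"
    have D: "W s - W t \<in> carrier_mat N m" by (rule minus_carrier_mat[OF W])
    have D0: "0 \<le> Re (mat_tr (mat_adjoint (W s - W t) * (W s - W t)))"
      using born_nonneg[OF povmD(1)[OF M, of UNIV] D] povmD(2)[OF M] mat_adjoint_carrier[OF D]
      by (simp add: born_def right_mult_one_mat[of _ m])
    \<comment> \<open>both laws are centred at the same point \<open>\<Psi> t\<close>, as the Cauchy-Schwarz bound requires\<close>
    have "g s - g t = (\<integral>x. x - \<Psi> t \<partial>\<mu> s) - (\<integral>x. x - \<Psi> t \<partial>\<mu> t)"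
      using S(3) Tm(3) by (simp add: g_def)
    also have "\<bar>\<dots>\<bar> \<le> sqrt (2 * ((\<integral>x. (x - \<Psi> t)\<^sup>2 \<partial>\<mu> s) + (\<integral>x. (x - \<Psi> t)\<^sup>2 \<partial>\<mu> t)))
      * sqrt (Re (mat_tr (mat_adjoint (W s - W t) * (W s - W t))))"
      unfolding \<mu>_def
      by (rule outcome_law_mean_difference[OF W W M]) (use S(1) Tm(1) in \<open>auto simp: \<mu>_def\<close>)
    also have "\<dots> \<le> sqrt (2 * ((sqrt r + L * h)\<^sup>2 + (sqrt r + L * h)\<^sup>2)) * sqrt (real n * h\<^sup>2)"
    proof (intro mult_mono real_sqrt_le_mono mult_left_mono add_mono)
      show "(\<integral>x. (x - \<Psi> t)\<^sup>2 \<partial>\<mu> s) \<le> (sqrt r + L * h)\<^sup>2"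
        using S(2) by (rule order_trans) (use lip[of s t] r0 in \<open>auto simp: h_def intro!: power_mono\<close>)
      show "(\<integral>x. (x - \<Psi> t)\<^sup>2 \<partial>\<mu> t) \<le> (sqrt r + L * h)\<^sup>2"
        using Tm(2) by (rule order_trans) (rule power_mono, use L0 r0 in \<open>auto simp: h_def\<close>)
    qed (use dist[of s t] D0 in \<open>auto simp: h_def\<close>)
    also have "2 * ((sqrt r + L * h)\<^sup>2 + (sqrt r + L * h)\<^sup>2) = (2 * (sqrt r + L * h))\<^sup>2"
      by (simp add: power2_eq_square algebra_simps)
    also have "sqrt \<dots> * sqrt (real n * h\<^sup>2) = 2 * (sqrt r + L * h) * (sqrt (real n) * h)"
      using r0 L0 by (simp add: h_def real_sqrt_mult)
    also have "\<dots> = (2 * (sqrt r * sqrt (real n)) + 2 * L * sqrt (real n) * h) * h"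
      by (simp add: algebra_simps)
    also have "sqrt r * sqrt (real n) = sqrt R" using n by (simp add: r_def flip: real_sqrt_mult)
    finally show ?thesis by (simp add: h_def)
  qed
  then have "\<bar>g T - g 0\<bar> \<le> 2 * sqrt R * T" by (rule chained_increment_bound[OF T])
  moreover have "\<bar>g t - \<Psi> t\<bar> \<le> sqrt r" if "t \<in> {0..T}" for t
    unfolding g_def by (rule shifted_second_moment(1)[OF fin total meas mom[OF that]])
  from this[of 0] this[of T] have "\<bar>g 0 - \<Psi> 0\<bar> \<le> sqrt r" "\<bar>g T - \<Psi> T\<bar> \<le> sqrt r" using T by auto
  ultimately have "\<Psi> T - \<Psi> 0 \<le> 2 * sqrt R * T + 2 * sqrt r" by linarith
  also have "sqrt r = sqrt R / sqrt (real n)" by (simp add: r_def real_sqrt_divide)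
  finally show ?thesis by (simp add: algebra_simps)
qed

section \<open>A curve of states of constant rank\<close>

text \<open>
  If \<open>B\<close> has mean 0 and variance 1 in the state \<open>\<rho> = R R\<^sup>*\<close>, then \<open>R\<close> and \<open>B R\<close> are orthonormal
  for the Hilbert-Schmidt inner product, and multiplying \<open>R\<close> by this operator moves it along the great
  circle through both.
\<close>

definition curve_op :: "nat \<Rightarrow> complex mat \<Rightarrow> real \<Rightarrow> complex mat" where
  "curve_op d B t = of_real (cos t) \<cdot>\<^sub>m 1\<^sub>m d + of_real (sin t) \<cdot>\<^sub>m B"

lemma curve_op_carrier [simp]: "B \<in> carrier_mat d d \<Longrightarrow> curve_op d B t \<in> carrier_mat d d"
  by (simp add: curve_op_def)

lemma curve_op_adjoint:
  assumes "self_adjoint d B"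
  shows "mat_adjoint (curve_op d B t) = curve_op d B t"
  using self_adjointD[OF assms] unfolding curve_op_def
  by (simp add: mat_adjoint_add[of _ d d] mat_adjoint_smult)

lemma curve_op_mult:
  assumes B: "B \<in> carrier_mat d d" and X: "X \<in> carrier_mat d d"
  shows "curve_op d B t * X = of_real (cos t) \<cdot>\<^sub>m X + of_real (sin t) \<cdot>\<^sub>m (B * X)"
    and "X * curve_op d B t = of_real (cos t) \<cdot>\<^sub>m X + of_real (sin t) \<cdot>\<^sub>m (X * B)"
proof -
  have s: "(c \<cdot>\<^sub>m Y) * Z = c \<cdot>\<^sub>m (Y * Z)" "Y * (c \<cdot>\<^sub>m Z) = c \<cdot>\<^sub>m (Y * Z)"
    if "Y \<in> carrier_mat d d" "Z \<in> carrier_mat d d" for Y Z :: "complex mat" and c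
    by (rule mult_smult_assoc_mat[OF that] mult_smult_distrib[OF that])+
  show "curve_op d B t * X = of_real (cos t) \<cdot>\<^sub>m X + of_real (sin t) \<cdot>\<^sub>m (B * X)"
    unfolding curve_op_def using B X
    by (simp add: add_mult_distrib_mat[of _ d d] s left_mult_one_mat[OF X])
  show "X * curve_op d B t = of_real (cos t) \<cdot>\<^sub>m X + of_real (sin t) \<cdot>\<^sub>m (X * B)"
    unfolding curve_op_def using B X
    by (simp add: mult_add_distrib_mat[of _ d d _ d] s right_mult_one_mat[OF X])
qed

lemma mat_tr_curve_op_mult:
  assumes B: "B \<in> carrier_mat d d" and X: "X \<in> carrier_mat d d"
  shows "mat_tr (curve_op d B t * X) = of_real (cos t) * mat_tr X + of_real (sin t) * mat_tr (B * X)"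
  unfolding curve_op_mult[OF assms] using B X by (simp add: mat_tr_add[of _ d] mat_tr_smult[of _ d])

lemma mat_tr_mult_curve_op_mult:
  assumes B: "B \<in> carrier_mat d d" and X: "X \<in> carrier_mat d d" and Y: "Y \<in> carrier_mat d d"
  shows "mat_tr (Y * (curve_op d B t * X)) = of_real (cos t) * mat_tr (Y * X) + of_real (sin t) * mat_tr (Y * (B * X))"
proof -
  have BX: "B * X \<in> carrier_mat d d" using B X by auto
  have "Y * (curve_op d B t * X) = of_real (cos t) \<cdot>\<^sub>m (Y * X) + of_real (sin t) \<cdot>\<^sub>m (Y * (B * X))"
    unfolding curve_op_mult[OF B X] using X Y BX
    by (simp add: mult_add_distrib_mat[of _ d d _ d] mult_smult_distrib[OF Y X] mult_smult_distrib[OF Y BX])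
  then show ?thesis using mult_carrier_mat[OF Y X] mult_carrier_mat[OF Y BX]
    by (simp add: mat_tr_add[of _ d] mat_tr_smult[of _ d])
qed

text \<open>
  Writing \<open>cos\<^sup>2 = 1 - sin\<^sup>2\<close> cancels \<open>X\<close> and leaves only terms that vanish with \<open>sin t\<close>.
\<close>

lemma curve_op_conj_difference:
  assumes B: "B \<in> carrier_mat d d" and X: "X \<in> carrier_mat d d"
  shows "curve_op d B t * X * curve_op d B t - X = of_real (- (sin t)\<^sup>2) \<cdot>\<^sub>m X
    + of_real (cos t * sin t) \<cdot>\<^sub>m (B * X + X * B) + of_real ((sin t)\<^sup>2) \<cdot>\<^sub>m (B * X * B)"
proof -
  let ?c = "complex_of_real (cos t)" and ?s = "complex_of_real (sin t)"
  have BX: "B * X \<in> carrier_mat d d" and XB: "X * B \<in> carrier_mat d d" using B X by auto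
  have BXB: "B * X * B \<in> carrier_mat d d" using BX B by auto
  have KX: "curve_op d B t * X = ?c \<cdot>\<^sub>m X + ?s \<cdot>\<^sub>m (B * X)" by (rule curve_op_mult[OF B X])
  have KXc: "?c \<cdot>\<^sub>m X + ?s \<cdot>\<^sub>m (B * X) \<in> carrier_mat d d" using X BX by auto
  have KXB: "(?c \<cdot>\<^sub>m X + ?s \<cdot>\<^sub>m (B * X)) * B = ?c \<cdot>\<^sub>m (X * B) + ?s \<cdot>\<^sub>m (B * X * B)"
    using X BX B by (simp add: add_mult_distrib_mat[of _ d d] mult_smult_assoc_mat[OF X B] mult_smult_assoc_mat[OF BX B])
  have e: "curve_op d B t * X * curve_op d B t
      = ?c \<cdot>\<^sub>m (?c \<cdot>\<^sub>m X + ?s \<cdot>\<^sub>m (B * X)) + ?s \<cdot>\<^sub>m (?c \<cdot>\<^sub>m (X * B) + ?s \<cdot>\<^sub>m (B * X * B))"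
    unfolding KX curve_op_mult(2)[OF B KXc] KXB ..
  show ?thesis
  proof (rule eq_matI)
    fix i j assume "i < dim_row (of_real (- (sin t)\<^sup>2) \<cdot>\<^sub>m X
      + of_real (cos t * sin t) \<cdot>\<^sub>m (B * X + X * B) + of_real ((sin t)\<^sup>2) \<cdot>\<^sub>m (B * X * B))"
      "j < dim_col (of_real (- (sin t)\<^sup>2) \<cdot>\<^sub>m X
      + of_real (cos t * sin t) \<cdot>\<^sub>m (B * X + X * B) + of_real ((sin t)\<^sup>2) \<cdot>\<^sub>m (B * X * B))"
    then have ij: "i < d" "j < d" using B by auto
    define x1 x2 x3 x4 where x: "x1 = X $$ (i, j)" "x2 = (B * X) $$ (i, j)" "x3 = (X * B) $$ (i, j)" "x4 = (B * X * B) $$ (i, j)"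
    have "?c * ?c = 1 - ?s * ?s"
      by (metis of_real_1 of_real_diff of_real_mult cos_squared_eq power2_eq_square)
    moreover have expand: "c * (c * x1 + s * x2) + s * (c * x3 + s * x4) - x1
      = (c * c) * x1 - x1 + c * s * (x2 + x3) + s * s * x4" for c s x1 x2 x3 x4 :: complex
      by (simp add: algebra_simps)
    ultimately have "?c * (?c * x1 + ?s * x2) + ?s * (?c * x3 + ?s * x4) - x1
      = - (?s * ?s) * x1 + ?c * ?s * (x2 + x3) + ?s * ?s * x4"
      using expand[of ?c x1 ?s x2 x3 x4] by (simp add: left_diff_distrib)
    then show "(curve_op d B t * X * curve_op d B t - X) $$ (i, j) = (of_real (- (sin t)\<^sup>2) \<cdot>\<^sub>m X
      + of_real (cos t * sin t) \<cdot>\<^sub>m (B * X + X * B) + of_real ((sin t)\<^sup>2) \<cdot>\<^sub>m (B * X * B)) $$ (i, j)"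
      unfolding e using ij carrier_matD[OF X] carrier_matD[OF BX] carrier_matD[OF XB] carrier_matD[OF BXB]
      by (simp add: x power2_eq_square del: index_mult_mat(1))
  qed (use B X in auto)
qed

text \<open>
  The determinant is continuous in \<open>t\<close> and equals 1 at 0.
\<close>

lemma curve_op_invertible_near_zero:
  assumes B: "B \<in> carrier_mat d d"
  obtains \<delta> where "\<delta> > 0" "\<And>t. \<bar>t\<bar> < \<delta> \<Longrightarrow> det (curve_op d B t) \<noteq> 0"
proof -
  have det: "det (curve_op d B t) = (\<Sum>p\<in>{p. p permutes {0..<d}}. signof p *
      (\<Prod>i = 0..<d. of_real (cos t) * 1\<^sub>m d $$ (i, p i) + of_real (sin t) * B $$ (i, p i)))" for t
  proof -
    have "det (curve_op d B t) = (\<Sum>p\<in>{p. p permutes {0..<d}}. signof p * (\<Prod>i = 0..<d. curve_op d B t $$ (i, p i)))"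
      using det_def'[OF curve_op_carrier[OF B]] by simp
    also have "\<dots> = (\<Sum>p\<in>{p. p permutes {0..<d}}. signof p *
      (\<Prod>i = 0..<d. of_real (cos t) * 1\<^sub>m d $$ (i, p i) + of_real (sin t) * B $$ (i, p i)))"
      using B by (intro sum.cong refl arg_cong2[of _ _ _ _ "(*)"] prod.cong) (auto simp: curve_op_def permutes_in_image)
    finally show ?thesis .
  qed
  have "continuous (at 0) (\<lambda>t. det (curve_op d B t))"
    unfolding det by (intro continuous_intros)
  moreover have "det (curve_op d B 0) \<noteq> 0"
  proof -
    have "curve_op d B 0 = 1\<^sub>m d" using B by (intro eq_matI) (auto simp: curve_op_def)
    then show ?thesis by simp
  qed
  ultimately obtain \<delta> where "\<delta> > 0" "\<forall>y. dist 0 y < \<delta> \<longrightarrow> det (curve_op d B y) \<noteq> 0"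
    using continuous_at_avoid by blast
  then show thesis by (intro that[of \<delta>]) auto
qed

text \<open>
  The case \<open>n = 1\<close> is \<open>1 - cos h = 2 sin\<^sup>2 (h / 2)\<close>. Each further factor \<open>cos h\<close> adds at most as much
  again.
\<close>

lemma one_minus_cos_power_le:
  fixes h :: real
  shows "1 - cos h ^ n \<le> real n * (h\<^sup>2 / 2)"
proof -
  have "1 - cos h = 2 * (sin (h / 2))\<^sup>2"
    using cos_double_sin[of "h / 2"] by simp
  also have "\<dots> \<le> 2 * (h / 2)\<^sup>2"
    using abs_sin_x_le_abs_x[of "h / 2"] by (simp only: abs_le_square_iff)
  finally have c: "1 - cos h \<le> h\<^sup>2 / 2" by (simp add: power2_eq_square)
  show ?thesis
  proof (induction n)
    case (Suc n)
    have "cos h ^ n \<le> 1" by (metis abs_cos_le_one abs_le_D1 abs_ge_zero power_abs power_le_one)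
    then have "cos h * (1 - cos h ^ n) \<le> 1 * (1 - cos h ^ n)" by (intro mult_right_mono) auto
    then have "1 - cos h ^ Suc n \<le> (1 - cos h) + (1 - cos h ^ n)" by (simp add: algebra_simps)
    then show ?case using Suc c by (simp add: algebra_simps)
  qed simp
qed

text \<open>
  The standing situation of the lower bound: \<open>B\<close> is the observable \<open>A\<close>, centred and normalised in the
  state \<open>\<rho>\<close>.
\<close>

locale state_curve =
  fixes d :: nat and \<rho> R B :: "complex mat"
  assumes R: "R \<in> carrier_mat d d" and factor: "\<rho> = R * mat_adjoint R" and tr: "mat_tr \<rho> = 1"
    and B: "self_adjoint d B" and centred: "mat_tr (B * \<rho>) = 0" and normalised: "mat_tr (B * (B * \<rho>)) = 1"
begin

lemma Bc: "B \<in> carrier_mat d d" and \<rho>c: "\<rho> \<in> carrier_mat d d"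
  using self_adjointD[OF B] R factor by auto

definition K :: "real \<Rightarrow> complex mat" where "K t = curve_op d B t"
definition W :: "real \<Rightarrow> complex mat" where "W t = K t * R"
definition \<rho>\<^sub>t :: "real \<Rightarrow> complex mat" where "\<rho>\<^sub>t t = K t * \<rho> * K t"

lemma Kc: "K t \<in> carrier_mat d d" and Ka: "mat_adjoint (K t) = K t"
  using Bc curve_op_adjoint[OF B] by (auto simp: K_def)

lemma Wc: "W t \<in> carrier_mat d d"
  unfolding W_def by (rule mult_carrier_mat[OF Kc R])

lemma W_gram: "W t * mat_adjoint (W t) = \<rho>\<^sub>t t"
proof -
  have "W t * mat_adjoint (W t) = K t * (R * mat_adjoint R) * K t"
    unfolding W_def mat_adjoint_mult[OF Kc R] Ka using Kc[of t] R mat_adjoint_carrier[OF R]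
    by (simp add: assoc_mult_mat[of _ d d _ d _ d] mult_carrier_mat[of _ d d])
  then show ?thesis by (simp only: \<rho>\<^sub>t_def flip: factor)
qed

lemma tr_KK: "mat_tr (K s * (K t * \<rho>)) = of_real (cos (s - t))"
proof -
  have Kr: "K t * \<rho> \<in> carrier_mat d d" by (rule mult_carrier_mat[OF Kc \<rho>c])
  show ?thesis
    using Kr unfolding K_def
    by (simp add: mat_tr_curve_op_mult[OF Bc] mat_tr_curve_op_mult[OF Bc \<rho>c]
      mat_tr_mult_curve_op_mult[OF Bc \<rho>c Bc] tr centred normalised cos_diff)
qed

lemma overlap: "mat_tr (mat_adjoint (W s) * W t) = of_real (cos (s - t))"
proof -
  note Ra = mat_adjoint_carrier[OF R]
  have "mat_tr (mat_adjoint (W s) * W t) = mat_tr (mat_adjoint R * (K s * (K t * R)))"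
    unfolding W_def mat_adjoint_mult[OF Kc R] Ka using Kc[of t] Kc[of s] R Ra
    by (simp add: assoc_mult_mat[of _ d d _ d _ d] mult_carrier_mat[of _ d d])
  also have "\<dots> = mat_tr (K s * (K t * R) * mat_adjoint R)"
    using Kc R by (intro mat_tr_comm[of _ d d]) (auto simp: mult_carrier_mat[of _ d d])
  also have "\<dots> = mat_tr (K s * (K t * \<rho>))"
    unfolding factor using Kc[of t] Kc[of s] R Ra
    by (simp add: assoc_mult_mat[of _ d d _ d _ d] mult_carrier_mat[of _ d d])
  finally show ?thesis by (simp add: tr_KK)
qed

lemma tr_B: "mat_tr (B * \<rho>\<^sub>t t) = 2 * of_real (sin t * cos t) + of_real ((sin t)\<^sup>2) * mat_tr (B * (B * (B * \<rho>)))"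
proof -
  have Kr: "K t * \<rho> \<in> carrier_mat d d" and Br: "B * \<rho> \<in> carrier_mat d d"
    using mult_carrier_mat[OF Kc \<rho>c] mult_carrier_mat[OF Bc \<rho>c] by auto
  have BKr: "B * (K t * \<rho>) \<in> carrier_mat d d" using Kr Bc by auto
  have BB: "B * B \<in> carrier_mat d d" using Bc by auto
  have assoc: "B * (B * X) = (B * B) * X" if "X \<in> carrier_mat d d" for X
    using Bc that by (simp add: assoc_mult_mat[of _ d d _ d _ d])
  have "mat_tr (B * \<rho>\<^sub>t t) = mat_tr ((B * (K t * \<rho>)) * K t)"
    unfolding \<rho>\<^sub>t_def using Kc[of t] \<rho>c Bc by (simp add: assoc_mult_mat[of _ d d _ d _ d] mult_carrier_mat[of _ d d])
  also have "\<dots> = mat_tr (K t * (B * (K t * \<rho>)))"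
    by (rule mat_tr_comm[OF BKr Kc])
  also have "\<dots> = of_real (cos t) * mat_tr (B * (K t * \<rho>)) + of_real (sin t) * mat_tr ((B * B) * (K t * \<rho>))"
    using mat_tr_curve_op_mult[OF Bc BKr, of t, folded K_def] by (simp add: assoc[OF Kr])
  also have "mat_tr (B * (K t * \<rho>)) = of_real (sin t)"
    unfolding K_def mat_tr_mult_curve_op_mult[OF Bc \<rho>c Bc] by (simp add: centred normalised)
  also have "mat_tr ((B * B) * (K t * \<rho>)) = of_real (cos t) + of_real (sin t) * mat_tr (B * (B * (B * \<rho>)))"
    unfolding K_def mat_tr_mult_curve_op_mult[OF Bc \<rho>c BB]
    unfolding assoc[OF \<rho>c, symmetric] assoc[OF Br, symmetric] by (simp add: normalised)
  finally show ?thesis by (simp add: power2_eq_square algebra_simps)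
qed

lemma state_\<rho>\<^sub>t: "state d (\<rho>\<^sub>t t)"
proof -
  have "mat_tr (\<rho>\<^sub>t t) = mat_tr (mat_adjoint (W t) * W t)"
    unfolding W_gram[symmetric] using Wc by (intro mat_tr_comm[of _ d d]) auto
  then show ?thesis
    using psd_gram[OF Wc, of t] by (simp add: state_def W_gram overlap)
qed

lemma \<rho>\<^sub>t_carrier: "\<rho>\<^sub>t t \<in> carrier_mat d d"
  unfolding \<rho>\<^sub>t_def by (rule mult_carrier_mat[OF mult_carrier_mat[OF Kc \<rho>c] Kc])

text \<open>
  By \<open>curve_op_conj_difference\<close> the difference is a combination of fixed matrices with coefficients
  that are at most \<open>\<bar>t\<bar>\<close> in modulus.
\<close>

lemma trace_norm_distance:
  obtains C where "C > 0" "\<And>t. trace_norm (\<rho>\<^sub>t t - \<rho>) \<le> C * \<bar>t\<bar>"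
proof -
  define c where "c i j = cmod (\<rho> $$ (i, j)) + cmod ((B * \<rho> + \<rho> * B) $$ (i, j)) + cmod ((B * \<rho> * B) $$ (i, j))" for i j
  have BR: "B * \<rho> + \<rho> * B \<in> carrier_mat d d" and BRB: "B * \<rho> * B \<in> carrier_mat d d"
    using Bc \<rho>c by (auto simp: mult_carrier_mat[of _ d d])
  have "trace_norm (\<rho>\<^sub>t t - \<rho>) \<le> real d * (\<Sum>i<d. \<Sum>j<d. c i j) * \<bar>t\<bar>" for t
  proof -
    have "psd d \<rho>" unfolding factor by (rule psd_gram[OF R])
    then have "self_adjoint d (\<rho>\<^sub>t t - \<rho>)"
      using psd_self_adjoint[of d \<rho>] state_\<rho>\<^sub>t[of t] psd_self_adjoint[of d "\<rho>\<^sub>t t"] \<rho>c \<rho>\<^sub>t_carrier[of t]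
      by (auto simp: self_adjoint_def state_def mat_adjoint_minus[of _ d d])
    then have "trace_norm (\<rho>\<^sub>t t - \<rho>) \<le> real d * (\<Sum>i<d. \<Sum>j<d. cmod ((\<rho>\<^sub>t t - \<rho>) $$ (i, j)))"
      by (rule trace_norm_le_entries)
    also have "\<dots> \<le> real d * (\<Sum>i<d. \<Sum>j<d. c i j * \<bar>t\<bar>)"
    proof (intro mult_left_mono sum_mono)
      fix i j assume "i \<in> {..<d}" "j \<in> {..<d}"
      then have ij: "i < d" "j < d" by auto
      have s: "\<bar>sin t\<bar> \<le> \<bar>t\<bar>" by (rule abs_sin_x_le_abs_x)
      have s2: "(sin t)\<^sup>2 \<le> \<bar>t\<bar>"
      proof -
        have "\<bar>sin t\<bar> * \<bar>sin t\<bar> \<le> \<bar>sin t\<bar> * 1" by (intro mult_left_mono) auto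
        then show ?thesis using s by (simp add: power2_eq_square flip: abs_mult)
      qed
      have cs: "\<bar>cos t * sin t\<bar> \<le> \<bar>t\<bar>"
      proof -
        have "\<bar>cos t\<bar> * \<bar>sin t\<bar> \<le> 1 * \<bar>sin t\<bar>" by (intro mult_right_mono) auto
        then show ?thesis using s by (simp add: abs_mult)
      qed
      have "(\<rho>\<^sub>t t - \<rho>) $$ (i, j) = of_real (- (sin t)\<^sup>2) * \<rho> $$ (i, j)
        + of_real (cos t * sin t) * (B * \<rho> + \<rho> * B) $$ (i, j) + of_real ((sin t)\<^sup>2) * (B * \<rho> * B) $$ (i, j)"
        unfolding \<rho>\<^sub>t_def K_def curve_op_conj_difference[OF Bc \<rho>c]
        using ij \<rho>c carrier_matD[OF BR] carrier_matD[OF BRB] by (simp del: index_mult_mat(1) of_real_minus of_real_mult of_real_power)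
      also have "cmod \<dots> \<le> cmod (of_real (- (sin t)\<^sup>2) * \<rho> $$ (i, j))
        + cmod (of_real (cos t * sin t) * (B * \<rho> + \<rho> * B) $$ (i, j)) + cmod (of_real ((sin t)\<^sup>2) * (B * \<rho> * B) $$ (i, j))"
        by (intro order_trans[OF norm_triangle_ineq] add_right_mono norm_triangle_ineq)
      also have "\<dots> = (sin t)\<^sup>2 * cmod (\<rho> $$ (i, j)) + \<bar>cos t * sin t\<bar> * cmod ((B * \<rho> + \<rho> * B) $$ (i, j))
        + (sin t)\<^sup>2 * cmod ((B * \<rho> * B) $$ (i, j))"
        unfolding norm_mult norm_of_real by simp
      also have "\<dots> \<le> \<bar>t\<bar> * cmod (\<rho> $$ (i, j)) + \<bar>t\<bar> * cmod ((B * \<rho> + \<rho> * B) $$ (i, j)) + \<bar>t\<bar> * cmod ((B * \<rho> * B) $$ (i, j))"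
        by (intro add_mono mult_right_mono s2 cs) auto
      finally show "cmod ((\<rho>\<^sub>t t - \<rho>) $$ (i, j)) \<le> c i j * \<bar>t\<bar>" by (simp add: c_def algebra_simps)
    qed simp
    finally show ?thesis by (simp add: sum_distrib_right mult.assoc)
  qed
  note bound = this
  have nn: "0 \<le> real d * (\<Sum>i<d. \<Sum>j<d. c i j)" 
    unfolding c_def by (intro mult_nonneg_nonneg sum_nonneg add_nonneg_nonneg) auto
  show thesis
  proof (rule that[of "real d * (\<Sum>i<d. \<Sum>j<d. c i j) + 1"])
    show "0 < real d * (\<Sum>i<d. \<Sum>j<d. c i j) + 1" using nn by simp
    show "trace_norm (\<rho>\<^sub>t t - \<rho>) \<le> (real d * (\<Sum>i<d. \<Sum>j<d. c i j) + 1) * \<bar>t\<bar>" for t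
      using bound[of t] by (simp add: distrib_right)
  qed
qed

text \<open>
  The squared distance of two unit vectors with real overlap \<open>cos (s - t) ^ n\<close> is
  \<open>2 - 2 cos (s - t) ^ n\<close>.
\<close>

lemma tensor_W_distance:
  defines "Wn \<equiv> \<lambda>n t. tensor_power (W t) n"
  shows "Re (mat_tr (mat_adjoint (Wn n s - Wn n t) * (Wn n s - Wn n t))) \<le> real n * (s - t)\<^sup>2"
proof -
  have c: "Wn n t \<in> carrier_mat (d ^ n) (d ^ n)" for t using Wc by (auto simp: Wn_def)
  have ov: "mat_tr (mat_adjoint (Wn n s) * Wn n t) = of_real (cos (s - t) ^ n)" for s t
    unfolding Wn_def tensor_power_adjoint tensor_power_mult[OF mat_adjoint_carrier[OF Wc] Wc]
    using mat_tr_tensor_power[OF mult_carrier_mat[OF mat_adjoint_carrier[OF Wc] Wc]] by (simp add: overlap)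
  have ac: "mat_adjoint (Wn n s) * Wn n t \<in> carrier_mat (d ^ n) (d ^ n)" for s t
    by (rule mult_carrier_mat[OF mat_adjoint_carrier[OF c] c])
  have "mat_adjoint (Wn n s - Wn n t) * (Wn n s - Wn n t)
    = (mat_adjoint (Wn n s) * Wn n s - mat_adjoint (Wn n t) * Wn n s)
      - (mat_adjoint (Wn n s) * Wn n t - mat_adjoint (Wn n t) * Wn n t)"
    unfolding mat_adjoint_minus[OF c c]
    unfolding mult_minus_distrib_mat[OF minus_carrier_mat[OF mat_adjoint_carrier[OF c]] c c]
      minus_mult_distrib_mat[OF mat_adjoint_carrier[OF c] mat_adjoint_carrier[OF c] c] ..
  then have "mat_tr (mat_adjoint (Wn n s - Wn n t) * (Wn n s - Wn n t)) = of_real (2 * (1 - cos (s - t) ^ n))"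
    using cos_minus[of "s - t"]
    by (simp add: mat_tr_minus[OF minus_carrier_mat[OF ac] minus_carrier_mat[OF ac]] mat_tr_minus[OF ac ac] ov)
  then show ?thesis using one_minus_cos_power_le[of "s - t" n] by simp
qed

end

section \<open>The sample mean of spectral measurements\<close>

lemma unitary_tensor_power:
  assumes "unitary_mat d U"
  shows "unitary_mat (d ^ n) (tensor_power U n)"
  using unitary_matD[OF assms]
  by (simp add: unitary_mat_def tensor_power_adjoint tensor_power_mult[of _ d d _ d] tensor_power_one)

lemma mat_tr_unitary_diag_mult:
  assumes U: "unitary_mat d U" and X: "X \<in> carrier_mat d d"
  shows "mat_tr (U * real_diag d l * mat_adjoint U * X) = (\<Sum>i<d. of_real (l i) * (mat_adjoint U * X * U) $$ (i, i))"
proof -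
  note u = unitary_matD[OF U]
  have UXU: "mat_adjoint U * X * U \<in> carrier_mat d d" using u(1,2) X by (simp add: mult_carrier_mat[of _ d d])
  have "mat_tr (U * real_diag d l * mat_adjoint U * X) = mat_tr (U * (real_diag d l * (mat_adjoint U * X)))"
    using u(1,2) X by (simp add: assoc_mult_mat[of _ d d _ d _ d] mult_carrier_mat[of _ d d])
  also have "\<dots> = mat_tr ((real_diag d l * (mat_adjoint U * X)) * U)"
    using u(1,2) X by (intro mat_tr_comm[of _ d d]) (simp_all add: mult_carrier_mat[of _ d d])
  also have "\<dots> = mat_tr (real_diag d l * (mat_adjoint U * X * U))"
    using u(1,2) X by (simp add: assoc_mult_mat[of _ d d _ d _ d] mult_carrier_mat[of _ d d])
  also have "\<dots> = (\<Sum>i<d. of_real (l i) * (mat_adjoint U * X * U) $$ (i, i))"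
    unfolding mat_tr_carrier[OF mult_carrier_mat[OF real_diag_carrier UXU]]
    by (intro sum.cong refl) (use real_diag_mult_index(1)[OF UXU] in \<open>simp del: index_mult_mat(1)\<close>)
  finally show ?thesis .
qed

definition spectral_measure :: "nat \<Rightarrow> complex mat \<Rightarrow> (nat \<Rightarrow> real) \<Rightarrow> real set \<Rightarrow> complex mat" where
  "spectral_measure N U x B = U * real_diag N (\<lambda>i. indicator B (x i)) * mat_adjoint U"

lemma povm_spectral_measure:
  assumes U: "unitary_mat N U"
  shows "povm N borel (spectral_measure N U x)"
  unfolding povm_def
proof (intro conjI ballI allI impI)
  note u = unitary_matD[OF U]
  show "psd N (spectral_measure N U x B)" for B
    unfolding spectral_measure_def by (rule psd_unitary_diag[OF U]) simp
  have "real_diag N (\<lambda>i. 1) = 1\<^sub>m N" by (intro eq_matI) (auto simp: real_diag_def)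
  then show "spectral_measure N U x (space borel) = 1\<^sub>m N"
    using u by (simp add: spectral_measure_def)
  fix F :: "nat \<Rightarrow> real set" and i j
  assume F: "disjoint_family F" and ij: "i < N" "j < N"
  have "(\<lambda>k. indicator (F k) y :: real) sums indicator (\<Union>k. F k) y" for y
    using F by (intro indicator_sums) (auto simp: disjoint_family_on_def)
  then show "(\<lambda>k. spectral_measure N U x (F k) $$ (i, j)) sums (spectral_measure N U x (\<Union>k. F k) $$ (i, j))"
    unfolding spectral_measure_def unitary_diag_index[OF U ij]
    by (intro sums_sum sums_mult2) (rule sums_of_real)
qed

text \<open>
  The law is the discrete distribution that gives the point \<open>x i\<close> the weight of the \<open>i\<close>-th vector of the
  eigenbasis; the values \<open>x i\<close> need not be distinct.
\<close>

lemma nn_integral_outcome_law_spectral_measure: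
  assumes U: "unitary_mat N U" and W: "W \<in> carrier_mat N m" and f: "f \<in> borel_measurable borel"
  defines "p \<equiv> \<lambda>i. Re ((mat_adjoint U * (W * mat_adjoint W) * U) $$ (i, i))"
  shows "(\<integral>\<^sup>+y. f y \<partial>outcome_law (W * mat_adjoint W) borel (spectral_measure N U x)) = (\<Sum>i<N. ennreal (p i) * f (x i))"
    and "\<And>i. i < N \<Longrightarrow> 0 \<le> p i"
proof -
  let ?M = "spectral_measure N U x"
  define \<mu> where "\<mu> = outcome_law (W * mat_adjoint W) borel ?M"
  note M = povm_spectral_measure[OF U, of x] and u = unitary_matD[OF U]
  have R: "W * mat_adjoint W \<in> carrier_mat N N" using W by auto
  have p: "0 \<le> p i" if "i < N" for i
    using psd_conj_diag_nonneg[OF psd_gram[OF W] u(1) that] by (simp add: p_def less_eq_complex_def)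
  then show "\<And>i. i < N \<Longrightarrow> 0 \<le> p i" .
  have fin: "finite_measure \<mu>" unfolding \<mu>_def by (rule finite_measure_outcome_law[OF W M])
  have sets: "sets \<mu> = sets borel" unfolding \<mu>_def by (rule sets_outcome_law[OF W M])
  have meas: "measure \<mu> B = (\<Sum>i<N. p i * indicator B (x i))" if "B \<in> sets borel" for B
  proof -
    have MB: "?M B \<in> carrier_mat N N" by (rule psd_carrier[OF povmD(1)[OF M that]])
    have "measure \<mu> B = born (?M B) W" unfolding \<mu>_def by (rule measure_outcome_law[OF W M that])
    also have "\<dots> = Re (mat_tr (?M B * (W * mat_adjoint W)))"
      unfolding born_eq_tr[OF W MB, symmetric] mat_tr_comm[OF R MB] ..
    also have "\<dots> = (\<Sum>i<N. p i * indicator B (x i))"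
      unfolding spectral_measure_def mat_tr_unitary_diag_mult[OF U R] by (simp add: p_def mult.commute)
    finally show ?thesis .
  qed
  have distr: "\<mu> = distr (point_measure {..<N} (\<lambda>i. ennreal (p i))) borel x"
  proof (rule measure_eqI)
    show "sets \<mu> = sets (distr (point_measure {..<N} (\<lambda>i. ennreal (p i))) borel x)" using sets by simp
    fix B assume "B \<in> sets \<mu>"
    then have B: "B \<in> sets borel" using sets by simp
    have "emeasure \<mu> B = ennreal (\<Sum>i<N. p i * indicator B (x i))"
      using fin meas[OF B] by (simp add: finite_measure.emeasure_eq_measure)
    also have "\<dots> = (\<Sum>i<N. ennreal (p i * indicator B (x i)))"
      using p by (intro sum_ennreal[symmetric]) auto
    also have "\<dots> = (\<Sum>i\<in>x -` B \<inter> {..<N}. ennreal (p i))"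
      by (intro sum.mono_neutral_cong_right) (auto split: split_indicator)
    also have "\<dots> = emeasure (point_measure {..<N} (\<lambda>i. ennreal (p i))) (x -` B \<inter> {..<N})"
      by (subst emeasure_point_measure_finite) auto
    also have "\<dots> = emeasure (distr (point_measure {..<N} (\<lambda>i. ennreal (p i))) borel x) B"
      using B by (subst emeasure_distr) (auto simp: space_point_measure)
    finally show "emeasure \<mu> B = emeasure (distr (point_measure {..<N} (\<lambda>i. ennreal (p i))) borel x) B" .
  qed
  show "(\<integral>\<^sup>+y. f y \<partial>outcome_law (W * mat_adjoint W) borel ?M) = (\<Sum>i<N. ennreal (p i) * f (x i))"
    unfolding \<mu>_def[symmetric] distr using f
    by (subst nn_integral_distr) (auto simp: nn_integral_point_measure_finite)
qed

text \<open>
  An index \<open>i < d ^ n\<close> of the tensor power stands for the tuple of its \<open>n\<close> digits in base \<open>d\<close>. The next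
  two functions are the sum of the eigenvalues and the product of the weights along these digits, so
  the moments below are those of a sum of \<open>n\<close> independent variables.
\<close>

primrec digit_sum :: "nat \<Rightarrow> (nat \<Rightarrow> real) \<Rightarrow> nat \<Rightarrow> nat \<Rightarrow> real" where
  "digit_sum d l 0 i = 0"
| "digit_sum d l (Suc n) i = l (i div d ^ n) + digit_sum d l n (i mod d ^ n)"

primrec digit_prod :: "nat \<Rightarrow> (nat \<Rightarrow> real) \<Rightarrow> nat \<Rightarrow> nat \<Rightarrow> real" where
  "digit_prod d q 0 i = 1"
| "digit_prod d q (Suc n) i = q (i div d ^ n) * digit_prod d q n (i mod d ^ n)"

lemma tensor_power_diag:
  assumes P: "P \<in> carrier_mat d d" and q: "\<And>a. a < d \<Longrightarrow> P $$ (a, a) = of_real (q a)" and i: "i < d ^ n"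
  shows "tensor_power P n $$ (i, i) = of_real (digit_prod d q n i)"
  using i
proof (induction n arbitrary: i)
  case (Suc n)
  then have "i < d * d ^ n" by simp
  note dm = div_mod_less[OF this]
  show ?case
    using Suc.prems dm(1) Suc.IH[OF dm(2)]
    by (simp add: kron_index q carrier_matD[OF P] carrier_matD[OF tensor_power_carrier[OF P]])
qed simp

lemma digit_prod_moments:
  assumes q: "(\<Sum>a<d. q a) = 1" and m: "(\<Sum>a<d. q a * l a) = m" and v: "(\<Sum>a<d. q a * (l a - m)\<^sup>2) = v"
  shows "(\<Sum>i<d ^ n. digit_prod d q n i) = 1"
    and "(\<Sum>i<d ^ n. digit_prod d q n i * (digit_sum d l n i - n * m)) = 0"
    and "(\<Sum>i<d ^ n. digit_prod d q n i * (digit_sum d l n i - n * m)\<^sup>2) = n * v"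
proof (induction n)
  case (Suc n)
  let ?p = "digit_prod d q n" and ?s = "\<lambda>i. digit_sum d l n i - real n * m"
  have m0: "(\<Sum>a<d. q a * (l a - m)) = 0"
    using q m by (simp add: right_diff_distrib sum_subtractf flip: sum_distrib_right)
  {
    case 1
    have "(\<Sum>i<d ^ Suc n. digit_prod d q (Suc n) i) = (\<Sum>i<d * d ^ n. (\<lambda>a b. q a * ?p b) (i div d ^ n) (i mod d ^ n))"
      by simp
    also have "\<dots> = (\<Sum>a<d. q a) * (\<Sum>b<d ^ n. ?p b)"
      unfolding sum_lessThan_div_mod[of "\<lambda>a b. q a * ?p b"] by (simp add: sum_product)
    finally show ?case using q Suc.IH(1) by simp
  next
    case 2
    have "(\<Sum>i<d ^ Suc n. digit_prod d q (Suc n) i * (digit_sum d l (Suc n) i - real (Suc n) * m))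
      = (\<Sum>i<d * d ^ n. (\<lambda>a b. q a * (l a - m) * ?p b + q a * (?p b * ?s b)) (i div d ^ n) (i mod d ^ n))"
      by (intro sum.cong) (simp_all add: algebra_simps)
    also have "\<dots> = (\<Sum>a<d. q a * (l a - m)) * (\<Sum>b<d ^ n. ?p b) + (\<Sum>a<d. q a) * (\<Sum>b<d ^ n. ?p b * ?s b)"
      unfolding sum_lessThan_div_mod[of "\<lambda>a b. q a * (l a - m) * ?p b + q a * (?p b * ?s b)"] by (simp add: sum_product sum.distrib)
    finally show ?case using m0 Suc.IH by simp
  next
    case 3
    have "(\<Sum>i<d ^ Suc n. digit_prod d q (Suc n) i * (digit_sum d l (Suc n) i - real (Suc n) * m)\<^sup>2)
      = (\<Sum>i<d * d ^ n. (\<lambda>a b. q a * (l a - m)\<^sup>2 * ?p b + 2 * (q a * (l a - m) * (?p b * ?s b)) + q a * (?p b * (?s b)\<^sup>2)) (i div d ^ n) (i mod d ^ n))"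
      by (intro sum.cong) (simp_all add: algebra_simps power2_eq_square)
    also have "\<dots> = (\<Sum>a<d. q a * (l a - m)\<^sup>2) * (\<Sum>b<d ^ n. ?p b)
        + 2 * ((\<Sum>a<d. q a * (l a - m)) * (\<Sum>b<d ^ n. ?p b * ?s b)) + (\<Sum>a<d. q a) * (\<Sum>b<d ^ n. ?p b * (?s b)\<^sup>2)"
      unfolding sum_lessThan_div_mod[of "\<lambda>a b. q a * (l a - m)\<^sup>2 * ?p b + 2 * (q a * (l a - m) * (?p b * ?s b)) + q a * (?p b * (?s b)\<^sup>2)"] 
      by (simp only: sum_product sum.distrib) (simp add: sum_distrib_left)
    finally show ?case using m0 Suc.IH q v by (simp add: algebra_simps)
  }
qed simp_all

text \<open>
  In the tensor power of an eigenbasis of \<open>A\<close> the diagonal of \<open>\<rho>\<^sup>\<otimes>\<^sup>n\<close> consists of the products of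
  the diagonal entries of \<open>\<rho>\<close>, so the \<open>n\<close> spectral measurements have independent outcomes, and the
  variance of their mean is the variance of one outcome divided by \<open>n\<close>.
\<close>

lemma sample_mean_risk:
  assumes A: "self_adjoint d A" and n: "0 < n"
  obtains M where "povm (d ^ n) borel M"
    "\<And>\<rho>. state d \<rho> \<Longrightarrow> quad_risk A n M \<rho> = ennreal (expval (A * A) \<rho> - (expval A \<rho>)\<^sup>2)"
proof -
  obtain U l where U: "unitary_mat d U" and Al: "A = U * real_diag d l * mat_adjoint U"
    using spectral_theorem[OF A] by blast
  note u = unitary_matD[OF U]
  define UU where "UU = tensor_power U n"
  have UU: "unitary_mat (d ^ n) UU" unfolding UU_def by (rule unitary_tensor_power[OF U])
  define x where "x i = digit_sum d l n i / real n" for i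
  define M where "M = spectral_measure (d ^ n) UU x"
  have risk: "quad_risk A n M \<rho> = ennreal (expval (A * A) \<rho> - (expval A \<rho>)\<^sup>2)" if \<rho>: "state d \<rho>" for \<rho>
  proof -
    have psd: "psd d \<rho>" and tr: "mat_tr \<rho> = 1" using \<rho> by (auto simp: state_def)
    note \<rho>c = psd_carrier[OF psd]
    obtain R where R: "R \<in> carrier_mat d d" and \<rho>R: "\<rho> = R * mat_adjoint R"
      using psd_factor[OF psd] .
    define W where "W = tensor_power R n"
    have W: "W \<in> carrier_mat (d ^ n) (d ^ n)" using R by (simp add: W_def)
    have \<rho>n: "tensor_power \<rho> n = W * mat_adjoint W"
      unfolding W_def \<rho>R tensor_power_adjoint tensor_power_mult[OF R mat_adjoint_carrier[OF R]] ..
    define P where "P = mat_adjoint U * \<rho> * U"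
    have P: "P \<in> carrier_mat d d" unfolding P_def using u(1,2) \<rho>c by (simp add: mult_carrier_mat[of _ d d])
    define q where "q a = Re (P $$ (a, a))" for a
    have Pq: "P $$ (a, a) = of_real (q a)" if "a < d" for a
      using psd_conj_diag_nonneg[OF psd u(1) that] by (simp add: P_def q_def less_eq_complex_def complex_eq_iff)
    have Pn: "mat_adjoint UU * (W * mat_adjoint W) * UU = tensor_power P n"
      unfolding UU_def P_def \<rho>n[symmetric] tensor_power_adjoint
      using u(1,2) \<rho>c mult_carrier_mat[OF u(2) \<rho>c] by (simp add: tensor_power_mult[of _ d d _ d])
    have q1: "(\<Sum>a<d. q a) = 1"
    proof -
      have "mat_tr (U * real_diag d (\<lambda>_. 1) * mat_adjoint U * \<rho>) = (\<Sum>a<d. of_real (q a))"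
        unfolding mat_tr_unitary_diag_mult[OF U \<rho>c] using Pq by (simp add: P_def)
      moreover have "real_diag d (\<lambda>_. 1) = 1\<^sub>m d" by (intro eq_matI) (auto simp: real_diag_def)
      ultimately have "mat_tr \<rho> = of_real (\<Sum>a<d. q a)"
        using u \<rho>c by (simp add: left_mult_one_mat[OF \<rho>c])
      then show ?thesis using tr by (metis of_real_1 of_real_eq_iff)
    qed
    have ev: "Re (mat_tr (U * real_diag d f * mat_adjoint U * \<rho>)) = (\<Sum>a<d. q a * f a)" for f
      unfolding mat_tr_unitary_diag_mult[OF U \<rho>c] by (simp add: P_def q_def mult.commute)
    define m where "m = expval A \<rho>"
    have m: "(\<Sum>a<d. q a * l a) = m" unfolding m_def expval_def Al ev ..
    have sq: "expval (A * A) \<rho> = (\<Sum>a<d. q a * (l a * l a))"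
      unfolding expval_def Al unitary_diag_square[OF U] ev ..
    define v where "v = (\<Sum>a<d. q a * (l a - m)\<^sup>2)"
    have "v = (\<Sum>a<d. q a * (l a * l a)) - 2 * m * (\<Sum>a<d. q a * l a) + m\<^sup>2 * (\<Sum>a<d. q a)"
      unfolding v_def sum_distrib_left sum.distrib[symmetric] sum_subtractf[symmetric]
      by (intro sum.cong) (auto simp: power2_eq_square algebra_simps)
    then have v: "v = expval (A * A) \<rho> - (expval A \<rho>)\<^sup>2"
      unfolding m q1 sq by (simp add: m_def power2_eq_square)
    define p where "p i = Re (tensor_power P n $$ (i, i))" for i
    have pd: "p i = digit_prod d q n i" if "i < d ^ n" for i
      unfolding p_def using tensor_power_diag[OF P Pq that] by simp
    have p0: "0 \<le> p i" if "i < d ^ n" for i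
      using nn_integral_outcome_law_spectral_measure(2)[OF UU W _ that, of "\<lambda>_. 0"] by (simp add: Pn p_def)
    have sqn: "(real n powr (1 / 2) * (y - m))\<^sup>2 = real n * (y - m)\<^sup>2" for y
      using n by (simp add: power_mult_distrib powr_half_sqrt)
    have "quad_risk A n M \<rho> = (\<Sum>i<d ^ n. ennreal (p i) * ennreal (real n * (x i - m)\<^sup>2))"
      unfolding quad_risk_def \<rho>n M_def m_def[symmetric] sqn
      by (subst nn_integral_outcome_law_spectral_measure(1)[OF UU W]) (auto simp: Pn p_def)
    also have "\<dots> = ennreal (\<Sum>i<d ^ n. p i * (real n * (x i - m)\<^sup>2))"
      using p0 by (subst sum_ennreal[symmetric]) (auto simp: ennreal_mult intro!: sum.cong)
    also have "(\<Sum>i<d ^ n. p i * (real n * (x i - m)\<^sup>2)) = (\<Sum>i<d ^ n. digit_prod d q n i * (digit_sum d l n i - real n * m)\<^sup>2) / real n"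
      unfolding sum_divide_distrib
      using n pd by (intro sum.cong) (auto simp: x_def field_simps power2_eq_square)
    also have "\<dots> = v"
      using digit_prod_moments(3)[OF q1 m v_def[symmetric]] n by simp
    finally show ?thesis unfolding v .
  qed
  show thesis
    by (rule that[of M]) (use risk povm_spectral_measure[OF UU] in \<open>auto simp: M_def\<close>)
qed

lemma expval_difference_le:
  assumes X: "X \<in> carrier_mat d d" and \<rho>: "state d \<rho>" and \<sigma>: "state d \<sigma>"
  shows "\<bar>expval X \<rho> - expval X \<sigma>\<bar> \<le> (\<Sum>i<d. \<Sum>k<d. cmod (X $$ (i, k))) * trace_norm (\<rho> - \<sigma>)"
proof -
  have r: "\<rho> \<in> carrier_mat d d" "\<sigma> \<in> carrier_mat d d" "self_adjoint d \<rho>" "self_adjoint d \<sigma>"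
    using \<rho> \<sigma> psd_self_adjoint psd_carrier by (auto simp: state_def)
  have sa: "self_adjoint d (\<rho> - \<sigma>)"
    using r by (auto simp: self_adjoint_def mat_adjoint_minus[of _ d d])
  have "expval X \<rho> - expval X \<sigma> = Re (\<Sum>i<d. \<Sum>k<d. X $$ (i, k) * (\<rho> - \<sigma>) $$ (k, i))"
    unfolding expval_def mat_tr_mult_sum[OF X r(1)] mat_tr_mult_sum[OF X r(2)] minus_complex.simps[symmetric] sum_subtractf[symmetric]
    using r by (intro arg_cong[of _ _ Re] sum.cong refl) (auto simp: right_diff_distrib)
  also have "\<bar>\<dots>\<bar> \<le> cmod (\<Sum>i<d. \<Sum>k<d. X $$ (i, k) * (\<rho> - \<sigma>) $$ (k, i))" by (rule abs_Re_le_cmod)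
  also have "\<dots> \<le> (\<Sum>i<d. \<Sum>k<d. cmod (X $$ (i, k)) * trace_norm (\<rho> - \<sigma>))"
    by (intro order_trans[OF norm_sum] sum_mono)
       (auto simp: norm_mult simp del: index_minus_mat intro!: mult_left_mono entry_le_trace_norm[OF sa])
  finally show ?thesis by (simp add: sum_distrib_right)
qed

text \<open>
  The mean value and the second moment are linear in the state. The factor in front of \<open>\<delta>\<close> would
  grow with \<open>\<delta>\<close> through the squared mean value, whence the restriction to \<open>\<delta> \<le> 1\<close>.
\<close>

lemma variance_difference_le:
  assumes A: "A \<in> carrier_mat d d" and \<sigma>: "state d \<sigma>"
  obtains C where "C \<ge> 0" "\<And>\<rho> \<delta>. state d \<rho> \<Longrightarrow> trace_norm (\<rho> - \<sigma>) \<le> \<delta> \<Longrightarrow> 0 \<le> \<delta> \<Longrightarrow> \<delta> \<le> 1 \<Longrightarrow>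
    expval (A * A) \<rho> - (expval A \<rho>)\<^sup>2 \<le> expval (A * A) \<sigma> - (expval A \<sigma>)\<^sup>2 + C * \<delta>"
proof -
  have AA: "A * A \<in> carrier_mat d d" using A by auto
  define c where "c X = (\<Sum>i<d. \<Sum>k<d. cmod (X $$ (i, k)))" for X :: "complex mat"
  have c0: "0 \<le> c X" for X by (auto simp: c_def intro!: sum_nonneg)
  define C where "C = c (A * A) + c A * (2 * \<bar>expval A \<sigma>\<bar> + c A)"
  show thesis
  proof (rule that[of C])
    show "C \<ge> 0" using c0 by (simp add: C_def)
    fix \<rho> \<delta> assume \<rho>: "state d \<rho>" "trace_norm (\<rho> - \<sigma>) \<le> \<delta>" "0 \<le> \<delta>" "\<delta> \<le> 1"
    have bd: "\<bar>expval X \<rho> - expval X \<sigma>\<bar> \<le> c X * \<delta>" if "X \<in> carrier_mat d d" for X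
      using expval_difference_le[OF that \<rho>(1) \<sigma>] mult_left_mono[OF \<rho>(2) c0[of X]] by (simp add: c_def)
    define a b where "a = expval A \<sigma>" and "b = expval A \<rho>"
    have ab: "\<bar>b - a\<bar> \<le> c A * \<delta>" using bd[OF A] by (simp add: a_def b_def)
    have "a\<^sup>2 - b\<^sup>2 = (a - b) * (2 * a + (b - a))" by (simp add: power2_eq_square algebra_simps)
    also have "\<dots> \<le> \<bar>a - b\<bar> * \<bar>2 * a + (b - a)\<bar>" by (metis abs_ge_self abs_mult)
    also have "\<dots> \<le> (c A * \<delta>) * (2 * \<bar>a\<bar> + c A)"
    proof (rule mult_mono)
      have "\<bar>b - a\<bar> \<le> c A" using ab mult_left_mono[OF \<rho>(4) c0[of A]] by simp
      then show "\<bar>2 * a + (b - a)\<bar> \<le> 2 * \<bar>a\<bar> + c A" by linarith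
    qed (use ab c0 \<rho> in auto)
    finally have "a\<^sup>2 - b\<^sup>2 \<le> (c A * \<delta>) * (2 * \<bar>a\<bar> + c A)" .
    moreover have "expval (A * A) \<rho> - expval (A * A) \<sigma> \<le> c (A * A) * \<delta>" using bd[OF AA] by simp
    ultimately show "expval (A * A) \<rho> - (expval A \<rho>)\<^sup>2 \<le> expval (A * A) \<sigma> - (expval A \<sigma>)\<^sup>2 + C * \<delta>"
      unfolding a_def[symmetric] b_def[symmetric] by (simp add: C_def a_def algebra_simps)
  qed
qed

section \<open>The local minimax risk\<close>

context state_curve
begin

text \<open>
  The bound along the curve for \<open>\<Psi> t = Tr (A \<rho>\<^sub>t)\<close>, with the left-hand side computed explicitly.
\<close>

lemma risk_lower_bound:
  assumes A: "A = of_real a \<cdot>\<^sub>m 1\<^sub>m d + of_real V \<cdot>\<^sub>m B" and V: "0 \<le> V"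
    and M: "povm (d ^ n) borel M" and n: "0 < n" and T: "0 \<le> T" and r: "0 \<le> r"
    and risk: "\<And>t. t \<in> {0..T} \<Longrightarrow> quad_risk A n M (\<rho>\<^sub>t t) \<le> ennreal r"
  shows "V * (2 * (sin T * cos T) + (sin T)\<^sup>2 * Re (mat_tr (B * (B * (B * \<rho>))))) \<le> 2 * sqrt r * (T + 1 / sqrt (real n))"
proof -
  define \<kappa> where "\<kappa> = Re (mat_tr (B * (B * (B * \<rho>))))"
  define \<Psi> where "\<Psi> t = a + V * (2 * (sin t * cos t) + (sin t)\<^sup>2 * \<kappa>)" for t
  have ev: "expval A (\<rho>\<^sub>t t) = \<Psi> t" for t
  proof -
    have "A * \<rho>\<^sub>t t = of_real a \<cdot>\<^sub>m \<rho>\<^sub>t t + of_real V \<cdot>\<^sub>m (B * \<rho>\<^sub>t t)"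
      unfolding A using \<rho>\<^sub>t_carrier[of t] Bc
      by (simp add: add_mult_distrib_mat[of _ d d _ _ d] mult_smult_assoc_mat[OF Bc \<rho>\<^sub>t_carrier]
        mult_smult_assoc_mat[OF one_carrier_mat \<rho>\<^sub>t_carrier] left_mult_one_mat[OF \<rho>\<^sub>t_carrier])
    then have "mat_tr (A * \<rho>\<^sub>t t) = of_real a * mat_tr (\<rho>\<^sub>t t) + of_real V * mat_tr (B * \<rho>\<^sub>t t)"
      using \<rho>\<^sub>t_carrier[of t] mult_carrier_mat[OF Bc \<rho>\<^sub>t_carrier[of t]]
      by (simp add: mat_tr_add[of _ d] mat_tr_smult[of _ d])
    then show ?thesis
      using state_\<rho>\<^sub>t[of t] unfolding expval_def tr_B
      by (simp add: state_def \<Psi>_def \<kappa>_def flip: of_real_mult of_real_power)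
  qed
  have lip: "\<bar>\<Psi> s - \<Psi> t\<bar> \<le> (V * (2 + 2 * \<bar>\<kappa>\<bar>)) * \<bar>s - t\<bar>" for s t
  proof -
    have sin_lip: "\<bar>sin x - sin y\<bar> \<le> \<bar>x - y\<bar>" for x y :: real
    proof -
      have "\<bar>sin x - sin y\<bar> = 2 * (\<bar>sin ((x - y) / 2)\<bar> * \<bar>cos ((x + y) / 2)\<bar>)"
        by (simp add: sin_diff_sin abs_mult)
      also have "\<dots> \<le> 2 * (\<bar>(x - y) / 2\<bar> * 1)"
        by (intro mult_left_mono mult_mono abs_sin_x_le_abs_x) auto
      finally show ?thesis by simp
    qed
    have dbl: "2 * (sin x * cos x) = sin (2 * x)" for x :: real by (simp add: sin_double)
    have two: "\<bar>2 * s - 2 * t\<bar> = 2 * \<bar>s - t\<bar>"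
      unfolding right_diff_distrib[symmetric] abs_mult by simp
    have s1: "\<bar>2 * (sin s * cos s) - 2 * (sin t * cos t)\<bar> \<le> 2 * \<bar>s - t\<bar>"
      unfolding dbl two[symmetric] by (rule sin_lip)
    have s2: "\<bar>(sin s)\<^sup>2 - (sin t)\<^sup>2\<bar> \<le> 2 * \<bar>s - t\<bar>"
    proof -
      have "\<bar>(sin s)\<^sup>2 - (sin t)\<^sup>2\<bar> = \<bar>sin s - sin t\<bar> * \<bar>sin s + sin t\<bar>"
        by (simp add: power2_eq_square algebra_simps flip: abs_mult)
      also have "\<dots> \<le> \<bar>s - t\<bar> * 2"
        using abs_sin_le_one[of s] abs_sin_le_one[of t] by (intro mult_mono sin_lip) linarith+
      finally show ?thesis by simp
    qed
    have "\<Psi> s - \<Psi> t = V * ((2 * (sin s * cos s) - 2 * (sin t * cos t)) + ((sin s)\<^sup>2 - (sin t)\<^sup>2) * \<kappa>)"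
      by (simp add: \<Psi>_def algebra_simps)
    also have "\<bar>\<dots>\<bar> = V * \<bar>(2 * (sin s * cos s) - 2 * (sin t * cos t)) + ((sin s)\<^sup>2 - (sin t)\<^sup>2) * \<kappa>\<bar>"
      using V by (simp add: abs_mult)
    also have "\<dots> \<le> V * (2 * \<bar>s - t\<bar> + (2 * \<bar>s - t\<bar>) * \<bar>\<kappa>\<bar>)"
      using V s1 s2 by (intro mult_left_mono order_trans[OF abs_triangle_ineq] add_mono) (auto simp: abs_mult intro!: mult_right_mono)
    finally show ?thesis by (simp add: algebra_simps)
  qed
  define Wn where "Wn t = tensor_power (W t) n" for t
  have Wn: "Wn t \<in> carrier_mat (d ^ n) (d ^ n)" for t using Wc by (simp add: Wn_def)
  have gram: "Wn t * mat_adjoint (Wn t) = tensor_power (\<rho>\<^sub>t t) n" for t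
    unfolding Wn_def tensor_power_adjoint tensor_power_mult[OF Wc mat_adjoint_carrier[OF Wc]] W_gram ..
  have one: "mat_tr (mat_adjoint (Wn t) * Wn t) = 1" for t
    unfolding Wn_def tensor_power_adjoint tensor_power_mult[OF mat_adjoint_carrier[OF Wc] Wc]
    using mat_tr_tensor_power[OF mult_carrier_mat[OF mat_adjoint_carrier[OF Wc] Wc]] by (simp add: overlap)
  have "\<Psi> T - \<Psi> 0 \<le> 2 * sqrt r * (T + 1 / sqrt (real n))"
  proof (rule estimation_bound_along_curve[OF M n T r Wn one _ lip])
    show "Re (mat_tr (mat_adjoint (Wn s - Wn t) * (Wn s - Wn t))) \<le> real n * (s - t)\<^sup>2" for s t
      unfolding Wn_def by (rule tensor_W_distance)
    show "(\<integral>\<^sup>+ x. ennreal ((real n powr (1 / 2) * (x - \<Psi> t))\<^sup>2) \<partial>outcome_law (Wn t * mat_adjoint (Wn t)) borel M) \<le> ennreal r"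
      if "t \<in> {0..T}" for t
      using risk[OF that] unfolding quad_risk_def gram ev .
  qed
  then show ?thesis by (simp add: \<Psi>_def \<kappa>_def)
qed

end

text \<open>
  This is \<open>risk_lower_bound\<close> on \<open>[0, T]\<close> with \<open>T = n\<^bsup>-3/8\<^esup>\<close>, solved for the risk. The constant
  \<open>\<kappa>\<close> is the third moment of the normalised observable; it disappears in the limit.
\<close>

lemma local_minimax_lower_bound:
  assumes \<rho>: "state d \<rho>" and rank: "vec_space.rank d \<rho> = r" and A: "self_adjoint d A"
    and pos: "0 < expval (A * A) \<rho> - (expval A \<rho>)\<^sup>2"
  obtains \<kappa> :: real where "\<forall>\<^sub>F n in sequentially. \<forall>M. povm (d ^ n) borel M \<longrightarrow>
    ennreal ((max 0 (sqrt (expval (A * A) \<rho> - (expval A \<rho>)\<^sup>2) *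
      (2 * (sin (real n powr (-3/8)) * cos (real n powr (-3/8))) + (sin (real n powr (-3/8)))\<^sup>2 * \<kappa>)
      / (2 * (real n powr (-3/8) + 1 / sqrt (real n)))))\<^sup>2)
    \<le> (SUP \<sigma>\<in>rank_state_ball d r n (1/4) \<rho>. quad_risk A n M \<sigma>)"
proof -
  have psd: "psd d \<rho>" and tr: "mat_tr \<rho> = 1" using \<rho> by (auto simp: state_def)
  note \<rho>c = psd_carrier[OF psd] and Ac = self_adjointD(1)[OF A]
  obtain R where R: "R \<in> carrier_mat d d" "\<rho> = R * mat_adjoint R" using psd_factor[OF psd] .
  define a where "a = expval A \<rho>"
  define V where "V = sqrt (expval (A * A) \<rho> - (expval A \<rho>)\<^sup>2)"
  have V: "V > 0" "V\<^sup>2 = expval (A * A) \<rho> - a\<^sup>2" using pos by (auto simp: V_def a_def)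
  define B where "B = of_real (1 / V) \<cdot>\<^sub>m (A - of_real a \<cdot>\<^sub>m 1\<^sub>m d)"
  have Bc: "B \<in> carrier_mat d d" by (simp add: B_def minus_carrier_mat)
  have Bsa: "self_adjoint d B"
    using self_adjointD[OF A] Bc unfolding self_adjoint_def
    by (simp add: B_def mat_adjoint_smult mat_adjoint_minus[of _ d d])
  have AB: "A = of_real a \<cdot>\<^sub>m 1\<^sub>m d + of_real V \<cdot>\<^sub>m B"
    using Ac V(1) unfolding B_def by (intro eq_matI) (auto simp: field_simps)
  \<comment> \<open>so that \<open>expval\<close>, defined as a real part, determines these traces\<close>
  have real: "Im (mat_tr (X * Y)) = 0" if "self_adjoint d X" "self_adjoint d Y" for X Y
  proof -
    note x = self_adjointD[OF that(1)] and y = self_adjointD[OF that(2)]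
    have "cnj (mat_tr (X * Y)) = mat_tr (mat_adjoint (X * Y))"
      using mat_tr_adjoint[OF mult_carrier_mat[OF x(1) y(1)]] by simp
    also have "\<dots> = mat_tr (X * Y)"
      unfolding mat_adjoint_mult[OF x(1) y(1)] x(2) y(2) by (rule mat_tr_comm[OF y(1) x(1)])
    finally show ?thesis by (simp add: complex_eq_iff)
  qed
  have \<rho>sa: "self_adjoint d \<rho>" by (rule psd_self_adjoint[OF psd])
  have A\<rho>: "A * \<rho> \<in> carrier_mat d d" using Ac \<rho>c by auto
  have AAsa: "self_adjoint d (A * A)"
    using self_adjointD[OF A] by (simp add: self_adjoint_def mat_adjoint_mult[OF Ac Ac] mult_carrier_mat[OF Ac Ac])
  have trA: "mat_tr (A * \<rho>) = of_real a"
    using real[OF A \<rho>sa] by (simp add: a_def expval_def complex_eq_iff)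
  have trAA: "mat_tr (A * (A * \<rho>)) = of_real (V\<^sup>2 + a\<^sup>2)"
    using real[OF AAsa \<rho>sa] V(2) Ac \<rho>c
    by (simp add: expval_def complex_eq_iff assoc_mult_mat[of _ d d _ d _ d])
  have BX: "mat_tr (B * X) = of_real (1 / V) * (mat_tr (A * X) - of_real a * mat_tr X)"
    if X: "X \<in> carrier_mat d d" for X
  proof -
    have m: "A - of_real a \<cdot>\<^sub>m 1\<^sub>m d \<in> carrier_mat d d" by (simp add: minus_carrier_mat)
    have AX: "A * X \<in> carrier_mat d d" using Ac X by auto
    have "B * X = of_real (1 / V) \<cdot>\<^sub>m (A * X - of_real a \<cdot>\<^sub>m X)"
      unfolding B_def mult_smult_assoc_mat[OF m X]
      using Ac X by (simp add: minus_mult_distrib_mat[of _ d d _ _ d] mult_smult_assoc_mat[OF one_carrier_mat X] left_mult_one_mat[OF X])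
    then show ?thesis using X AX
      by (simp add: mat_tr_smult[of _ d] mat_tr_minus[of _ d] minus_carrier_mat)
  qed
  have B\<rho>c: "B * \<rho> \<in> carrier_mat d d" using Bc \<rho>c by auto
  have centred: "mat_tr (B * \<rho>) = 0" unfolding BX[OF \<rho>c] trA tr by simp
  \<comment> \<open>the covariance of \<open>A\<close> and \<open>B\<close>; cyclicity of the trace moves \<open>B\<close> into the place where \<open>BX\<close> applies\<close>
  have "mat_tr (A * (B * \<rho>)) = of_real V"
  proof -
    have "mat_tr (A * (B * \<rho>)) = mat_tr ((B * \<rho>) * A)" by (rule mat_tr_comm[OF Ac B\<rho>c])
    also have "\<dots> = mat_tr (B * (\<rho> * A))" using Bc \<rho>c Ac by (simp add: assoc_mult_mat[of _ d d _ d _ d])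
    also have "\<dots> = of_real (1 / V) * (mat_tr (A * (\<rho> * A)) - of_real a * mat_tr (\<rho> * A))"
      using \<rho>c Ac by (intro BX) auto
    also have "mat_tr (\<rho> * A) = mat_tr (A * \<rho>)" by (rule mat_tr_comm[OF \<rho>c Ac])
    also have "mat_tr (A * (\<rho> * A)) = mat_tr ((A * \<rho>) * A)" using \<rho>c Ac by (simp add: assoc_mult_mat[of _ d d _ d _ d])
    also have "\<dots> = mat_tr (A * (A * \<rho>))" by (rule mat_tr_comm[OF A\<rho> Ac])
    finally show ?thesis unfolding trA trAA using V(1) by (simp add: power2_eq_square)
  qed
  then have normalised: "mat_tr (B * (B * \<rho>)) = 1"
    unfolding BX[OF B\<rho>c] centred using V(1) by simp
  interpret state_curve d \<rho> R B
    by unfold_locales (use R tr Bsa centred normalised in auto)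
  obtain C where C: "C > 0" "\<And>t. trace_norm (\<rho>\<^sub>t t - \<rho>) \<le> C * \<bar>t\<bar>" using trace_norm_distance by blast
  obtain \<delta> where \<delta>: "\<delta> > 0" "\<And>t. \<bar>t\<bar> < \<delta> \<Longrightarrow> det (K t) \<noteq> 0"
    using curve_op_invertible_near_zero[OF Bc] unfolding K_def by metis
  define \<kappa> where "\<kappa> = Re (mat_tr (B * (B * (B * \<rho>))))"
  have e1: "\<forall>\<^sub>F n::nat in sequentially. real n powr (-3/8) < \<delta>"
    using \<delta>(1) by real_asymp
  have e2: "\<forall>\<^sub>F n::nat in sequentially. C * real n powr (-3/8) \<le> real n powr (- 1 / 2 + 1 / 4)"
    using C(1) by real_asymp
  show thesis
  proof (rule that[of \<kappa>], use e1 e2 eventually_gt_at_top[of 0] in eventually_elim, intro allI impI)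
    fix n :: nat and M :: "real set \<Rightarrow> complex mat"
    assume n: "real n powr (-3/8) < \<delta>" "C * real n powr (-3/8) \<le> real n powr (- 1 / 2 + 1 / 4)" "0 < n"
      and M: "povm (d ^ n) borel M"
    define T where "T = real n powr (-3/8)"
    define \<phi> where "\<phi> = V * (2 * (sin T * cos T) + (sin T)\<^sup>2 * \<kappa>)"
    define D where "D = 2 * (T + 1 / sqrt (real n))"
    have T: "0 < T" using n(3) by (simp add: T_def)
    have D: "0 < D" using T by (simp add: D_def add_pos_nonneg)
    let ?S = "SUP \<sigma>\<in>rank_state_ball d r n (1/4) \<rho>. quad_risk A n M \<sigma>"
    have ball: "\<rho>\<^sub>t t \<in> rank_state_ball d r n (1/4) \<rho>" if t: "t \<in> {0..T}" for t
    proof -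
      have "vec_space.rank d (\<rho>\<^sub>t t) = r"
        unfolding \<rho>\<^sub>t_def rank[symmetric]
        by (rule rank_conj_invertible[OF \<rho>c Kc \<delta>(2)]) (use t n(1) in \<open>auto simp: T_def\<close>)
      moreover have "trace_norm (\<rho>\<^sub>t t - \<rho>) \<le> real n powr (- 1 / 2 + 1 / 4)"
      proof (rule order_trans[OF C(2) order_trans[OF _ n(2)]])
        show "C * \<bar>t\<bar> \<le> C * real n powr (-3/8)"
          using C(1) t by (intro mult_left_mono) (auto simp: T_def)
      qed
      ultimately show ?thesis using state_\<rho>\<^sub>t by (simp add: rank_state_ball_def)
    qed
    have "ennreal ((max 0 (\<phi> / D))\<^sup>2) \<le> ?S"
    proof (cases ?S)
      case (real s)
      have "quad_risk A n M (\<rho>\<^sub>t t) \<le> ennreal s" if "t \<in> {0..T}" for t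
        using SUP_upper[OF ball[OF that], of "quad_risk A n M"] real(2) by simp
      from risk_lower_bound[OF AB _ M n(3) _ real(1) this] V(1) T
      have "\<phi> \<le> sqrt s * D" by (simp add: \<phi>_def \<kappa>_def D_def algebra_simps)
      then have "\<phi> / D \<le> sqrt s" using D by (simp add: divide_le_eq)
      then have "max 0 (\<phi> / D) \<le> sqrt s" using real(1) by simp
      then have "(max 0 (\<phi> / D))\<^sup>2 \<le> (sqrt s)\<^sup>2" by (intro power_mono) auto
      then show ?thesis unfolding real(2) using real(1) by (intro ennreal_leI) simp
    next
      case top
      show ?thesis unfolding top by (rule top_greatest)
    qed
    then show "ennreal ((max 0 (sqrt (expval (A * A) \<rho> - (expval A \<rho>)\<^sup>2) *
      (2 * (sin (real n powr (-3/8)) * cos (real n powr (-3/8))) + (sin (real n powr (-3/8)))\<^sup>2 * \<kappa>)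
      / (2 * (real n powr (-3/8) + 1 / sqrt (real n)))))\<^sup>2) \<le> ?S"
      unfolding V_def[symmetric] T_def[symmetric] \<phi>_def[symmetric] D_def[symmetric] .
  qed
qed

theorem theorem6p1:
  fixes d r :: nat and \<rho>\<^sub>0 A :: "complex mat"
  assumes "state d \<rho>\<^sub>0"
    and "vec_space.rank d \<rho>\<^sub>0 = r"
    and "self_adjoint d A"
  shows "\<exists>\<epsilon>::real. 0 < \<epsilon> \<and> \<epsilon> < 1 / 2 \<and>
    (\<lambda>n. INF M\<in>{M. povm (d ^ n) borel M}. SUP \<rho>\<in>rank_state_ball d r n \<epsilon> \<rho>\<^sub>0. quad_risk A n M \<rho>)
      \<longlonglongrightarrow> ennreal (expval (A * A) \<rho>\<^sub>0 - (expval A \<rho>\<^sub>0)\<^sup>2)"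
proof (intro exI[of _ "1/4"] conjI)
  define v where "v = expval (A * A) \<rho>\<^sub>0 - (expval A \<rho>\<^sub>0)\<^sup>2"
  let ?L = "\<lambda>n. INF M\<in>{M. povm (d ^ n) borel M}. SUP \<rho>\<in>rank_state_ball d r n (1/4) \<rho>\<^sub>0. quad_risk A n M \<rho>"
  obtain C where C: "C \<ge> 0" "\<And>\<rho> \<delta>. state d \<rho> \<Longrightarrow> trace_norm (\<rho> - \<rho>\<^sub>0) \<le> \<delta> \<Longrightarrow> 0 \<le> \<delta> \<Longrightarrow> \<delta> \<le> 1 \<Longrightarrow>
    expval (A * A) \<rho> - (expval A \<rho>)\<^sup>2 \<le> v + C * \<delta>"
    using variance_difference_le[OF self_adjointD(1)[OF assms(3)] assms(1)] unfolding v_def by blast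
  have upper: "\<forall>\<^sub>F n in sequentially. ?L n \<le> ennreal (v + C * real n powr (- 1 / 2 + 1 / 4))"
  proof (use eventually_gt_at_top[of 0] in eventually_elim)
    fix n :: nat assume n: "0 < n"
    obtain M where M: "povm (d ^ n) borel M"
      "\<And>\<rho>. state d \<rho> \<Longrightarrow> quad_risk A n M \<rho> = ennreal (expval (A * A) \<rho> - (expval A \<rho>)\<^sup>2)"
      using sample_mean_risk[OF assms(3) n] by blast
    have le1: "real n powr (- 1 / 2 + 1 / 4) \<le> 1"
      using n by (simp add: powr_le_one_le powr_mono2' powr_minus_divide divide_le_eq ge_one_powr_ge_zero)
    have "?L n \<le> (SUP \<rho>\<in>rank_state_ball d r n (1/4) \<rho>\<^sub>0. quad_risk A n M \<rho>)"
      using M(1) by (intro INF_lower) auto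
    also have "\<dots> \<le> ennreal (v + C * real n powr (- 1 / 2 + 1 / 4))"
    proof (rule SUP_least)
      fix \<rho> assume "\<rho> \<in> rank_state_ball d r n (1/4) \<rho>\<^sub>0"
      then have "state d \<rho>" "trace_norm (\<rho> - \<rho>\<^sub>0) \<le> real n powr (- 1 / 2 + 1 / 4)"
        by (auto simp: rank_state_ball_def)
      then show "quad_risk A n M \<rho> \<le> ennreal (v + C * real n powr (- 1 / 2 + 1 / 4))"
        unfolding M(2)[OF \<open>state d \<rho>\<close>] by (intro ennreal_leI C(2)) (use le1 in auto)
    qed
    finally show "?L n \<le> ennreal (v + C * real n powr (- 1 / 2 + 1 / 4))" .
  qed
  have upper_lim: "(\<lambda>n. ennreal (v + C * real n powr (- 1 / 2 + 1 / 4))) \<longlonglongrightarrow> ennreal v"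
  proof (intro tendsto_ennrealI)
    have "(\<lambda>n. real n powr (- 1 / 2 + 1 / 4)) \<longlonglongrightarrow> 0" by real_asymp
    from tendsto_add[OF tendsto_const tendsto_mult[OF tendsto_const this], of v C]
    show "(\<lambda>n. v + C * real n powr (- 1 / 2 + 1 / 4)) \<longlonglongrightarrow> v" by simp
  qed
  show "?L \<longlonglongrightarrow> ennreal (expval (A * A) \<rho>\<^sub>0 - (expval A \<rho>\<^sub>0)\<^sup>2)"
  proof (cases "0 < v")
    case True
    obtain \<kappa> :: real where k: "\<forall>\<^sub>F n in sequentially. \<forall>M. povm (d ^ n) borel M \<longrightarrow>
      ennreal ((max 0 (sqrt v *
        (2 * (sin (real n powr (-3/8)) * cos (real n powr (-3/8))) + (sin (real n powr (-3/8)))\<^sup>2 * \<kappa>)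
        / (2 * (real n powr (-3/8) + 1 / sqrt (real n)))))\<^sup>2)
      \<le> (SUP \<sigma>\<in>rank_state_ball d r n (1/4) \<rho>\<^sub>0. quad_risk A n M \<sigma>)"
      using local_minimax_lower_bound[OF assms True[unfolded v_def]] unfolding v_def by blast
    \<comment> \<open>the risk is at least \<open>v f\<^sup>2\<close> once \<open>f\<close> is positive; the maximum with 0 covers the remaining \<open>n\<close>\<close>
    define f where "f n = (2 * (sin (real n powr (-3/8)) * cos (real n powr (-3/8))) + (sin (real n powr (-3/8)))\<^sup>2 * \<kappa>)
        / (2 * (real n powr (-3/8) + 1 / sqrt (real n)))" for n :: nat
    have lower: "\<forall>\<^sub>F n in sequentially. ennreal ((max 0 (sqrt v * f n))\<^sup>2) \<le> ?L n"
      using k by eventually_elim (auto simp: f_def intro!: INF_greatest)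
    have "f \<longlonglongrightarrow> 1"
      unfolding f_def by real_asymp
    then have "(\<lambda>n. (max 0 (sqrt v * f n))\<^sup>2) \<longlonglongrightarrow> (max 0 (sqrt v * 1))\<^sup>2"
      by (intro tendsto_intros)
    then have "(\<lambda>n. ennreal ((max 0 (sqrt v * f n))\<^sup>2)) \<longlonglongrightarrow> ennreal v"
      using True by (intro tendsto_ennrealI) simp
    from tendsto_sandwich[OF lower upper this upper_lim] show ?thesis unfolding v_def .
  next
    case False
    \<comment> \<open>the variance is not positive, so its \<open>ennreal\<close> value is 0 and the upper bound suffices\<close>
    have "ennreal v = 0" using False by (simp add: ennreal_neg)
    then show ?thesis
      using tendsto_sandwich[OF always_eventually upper tendsto_const, of 0] upper_lim by (simp add: v_def)
  qed
qed auto

end
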